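(* Let $n \in \mathbb{N}$ be given and let $K$ be a field. Let $f,g \in \mathcal{G}_K^a(n)$ be quasi-independent elements of order $\ell^{n-a}$ and $\ell^{n-b}$ respectively; in particular, $$\langle f,g \rangle = \langle f \rangle \oplus \langle g \rangle \cong (\mathbb{Z}/\ell^{n-a}) \cdot f \oplus (\mathbb{Z}/\ell^{n-b}) \cdot g.$$ Let $T := \ker f \cap \ker g$, and let $0 \leq c \leq n$ be such that $K_2^M(K)/T$ has order $\ell^{n-c}$. Then $f,g$ form a C-pair if and only if $c \leq a+b$.
   Context: $\ell$ is a fixed prime, $\mathbb N=\{1,2,\dots\}$, $R_n=\mathbb Z/\ell^n$. $\mathcal G_K^a(n)=\mathrm{Hom}(K^\times/\{\pm1\},R_n)$; its elements are regarded as homomorphisms $f:K^\times\to R_n$ with $f(-1)=0$. Elements $f,g\in\mathcal G_K^a(n)$ form a C-pair if $f(1-x)g(x)=f(x)g(1-x)$ for all $x\in K\smallsetminus\{0,1\}$. A collection of non-zero elements $(f_i)_i$ of an $R_n$-module is quasi-independent if whenever $a_i\in R_n$, almost all zero, satisfy $\sum_i a_if_i=0$, then $a_if_i=0$ for all $i$. For a subgroup $T\le K^\times$, $$K_2^M(K)/T=\frac{(K^\times/T)\otimes(K^\times/T)}{\langle xT\otimes yT\ :\ 1\in xT+yT\rangle},$$ i.e. the degree-2 part of the quotient of the Milnor K-ring $K_*^M(K)$ by the graded ideal generated by $T\le K^\times=K_1^M(K)$. *)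

theory Defs
  imports
    "HOL-Number_Theory.Residues"
    "HOL-Algebra.Module"
    "HOL-Algebra.Free_Abelian_Groups"
begin

abbreviation Rn :: "nat \<Rightarrow> nat \<Rightarrow> int ring"
  where "Rn l n \<equiv> residue_ring (int l ^ n)"

text \<open>
  Elements are homomorphisms from the unit group to the additive group of the coefficient ring
  that vanish at \<open>-1\<close>. They are extensional on the units, so that equality in the carrier is equality
  of homomorphisms. The fields \<open>mult\<close> and \<open>one\<close> of the record play no role in the module structure.
\<close>

definition GKa :: "('a, 'b) ring_scheme \<Rightarrow> nat \<Rightarrow> nat \<Rightarrow> (int, 'a \<Rightarrow> int) module"
  where "GKa K l n =
    \<lparr>carrier = {f \<in> hom (units_of K) (add_monoid (Rn l n)).
                  f \<in> extensional (Units K) \<and> f (\<ominus>\<^bsub>K\<^esub> \<one>\<^bsub>K\<^esub>) = \<zero>\<^bsub>Rn l n\<^esub>},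
     monoid.mult = (\<lambda>f g. undefined),
     monoid.one = undefined,
     ring.zero = (\<lambda>x\<in>Units K. \<zero>\<^bsub>Rn l n\<^esub>),
     ring.add = (\<lambda>f g. \<lambda>x\<in>Units K. f x \<oplus>\<^bsub>Rn l n\<^esub> g x),
     smult = (\<lambda>r f. \<lambda>x\<in>Units K. r \<otimes>\<^bsub>Rn l n\<^esub> f x)\<rparr>"

definition C_pair ::
    "('a, 'b) ring_scheme \<Rightarrow> nat \<Rightarrow> nat \<Rightarrow> ('a \<Rightarrow> int) \<Rightarrow> ('a \<Rightarrow> int) \<Rightarrow> bool"
  where "C_pair K l n f g \<longleftrightarrow>
    (\<forall>x \<in> carrier K - {\<zero>\<^bsub>K\<^esub>, \<one>\<^bsub>K\<^esub>}.
       f (\<one>\<^bsub>K\<^esub> \<ominus>\<^bsub>K\<^esub> x) \<otimes>\<^bsub>Rn l n\<^esub> g x = f x \<otimes>\<^bsub>Rn l n\<^esub> g (\<one>\<^bsub>K\<^esub> \<ominus>\<^bsub>K\<^esub> x))"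

definition quasi_independent ::
    "('r, 's) ring_scheme \<Rightarrow> ('r, 'm, 't) module_scheme \<Rightarrow> 'i set \<Rightarrow> ('i \<Rightarrow> 'm) \<Rightarrow> bool"
  where "quasi_independent R M I f \<longleftrightarrow>
    (\<forall>i\<in>I. f i \<in> carrier M \<and> f i \<noteq> \<zero>\<^bsub>M\<^esub>) \<and>
    (\<forall>c \<in> I \<rightarrow> carrier R.
       finite {i \<in> I. c i \<noteq> \<zero>\<^bsub>R\<^esub>} \<and>
       (\<Oplus>\<^bsub>M\<^esub>i \<in> {i \<in> I. c i \<noteq> \<zero>\<^bsub>R\<^esub>}. c i \<odot>\<^bsub>M\<^esub> f i) = \<zero>\<^bsub>M\<^esub> \<longrightarrow>
       (\<forall>i\<in>I. c i \<odot>\<^bsub>M\<^esub> f i = \<zero>\<^bsub>M\<^esub>))"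

text \<open>
  The tensor product over the integers of two commutative groups, as the free abelian group on
  pairs modulo bilinearity. The groups \<open>G\<close> and \<open>H\<close> are written multiplicatively, the free abelian
  group (type \<open>\<Rightarrow>\<^sub>0 int\<close>) additively.
\<close>

definition tensor_relations ::
    "('a, 'c) monoid_scheme \<Rightarrow> ('b, 'd) monoid_scheme \<Rightarrow> ('a \<times> 'b \<Rightarrow>\<^sub>0 int) set"
  where "tensor_relations G H =
    {frag_of (x \<otimes>\<^bsub>G\<^esub> x', y) - frag_of (x, y) - frag_of (x', y) | x x' y.
       x \<in> carrier G \<and> x' \<in> carrier G \<and> y \<in> carrier H} \<union>
    {frag_of (x, y \<otimes>\<^bsub>H\<^esub> y') - frag_of (x, y) - frag_of (x, y') | x y y'.
       x \<in> carrier G \<and> y \<in> carrier H \<and> y' \<in> carrier H}"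

definition tensor_kernel ::
    "('a, 'c) monoid_scheme \<Rightarrow> ('b, 'd) monoid_scheme \<Rightarrow> ('a \<times> 'b \<Rightarrow>\<^sub>0 int) set"
  where "tensor_kernel G H =
    generate (free_Abelian_group (carrier G \<times> carrier H)) (tensor_relations G H)"

definition tensor_product ::
    "('a, 'c) monoid_scheme \<Rightarrow> ('b, 'd) monoid_scheme \<Rightarrow> ('a \<times> 'b \<Rightarrow>\<^sub>0 int) set monoid"
  where "tensor_product G H =
    free_Abelian_group (carrier G \<times> carrier H) Mod tensor_kernel G H"

definition pure_tensor ::
    "('a, 'c) monoid_scheme \<Rightarrow> ('b, 'd) monoid_scheme \<Rightarrow> 'a \<Rightarrow> 'b \<Rightarrow> ('a \<times> 'b \<Rightarrow>\<^sub>0 int) set"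
  where "pure_tensor G H x y =
    tensor_kernel G H #>\<^bsub>free_Abelian_group (carrier G \<times> carrier H)\<^esub> frag_of (x, y)"

text \<open>
  Elements of \<open>units_of K Mod T\<close> are cosets of \<open>T\<close>, i.e. subsets of \<open>K\<close>, so the relation
  \<open>1 \<in> xT + yT\<close> is expressed with the elementwise sum of subsets of the ring \<open>K\<close>.
\<close>

definition K2M_mod ::
    "('a, 'b) ring_scheme \<Rightarrow> 'a set \<Rightarrow> ('a set \<times> 'a set \<Rightarrow>\<^sub>0 int) set set monoid"
  where "K2M_mod K T =
    (let A = units_of K Mod T;
         S = {pure_tensor A A (T #>\<^bsub>units_of K\<^esub> x) (T #>\<^bsub>units_of K\<^esub> y) | x y.
                x \<in> Units K \<and> y \<in> Units K \<and>
                \<one>\<^bsub>K\<^esub> \<in> (T #>\<^bsub>units_of K\<^esub> x) <+>\<^bsub>K\<^esub> (T #>\<^bsub>units_of K\<^esub> y)}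
     in tensor_product A A Mod generate (tensor_product A A) S)"

end

theory Submission
  imports Defs
begin

text \<open>
  Write \<open>N = l ^ n\<close> and \<open>Q\<close> for the group \<open>K2M_mod K T\<close>; the class in \<open>Q\<close> of the pure tensor of
  the cosets of \<open>x\<close> and \<open>y\<close> is the symbol \<open>{x, y}\<close>.

  Independence of \<open>f\<close> and \<open>g\<close> forces the map \<open>(f, g)\<close> from \<open>K\<close>-units to pairs of residues to have
  the largest possible image, all pairs \<open>(l ^ a i, l ^ b j)\<close>, an instance of duality for finite
  abelian groups. Indeed, if the values of \<open>f\<close> on the kernel of \<open>g\<close> were all divisible by
  \<open>l ^ (a + 1)\<close>, some nonzero multiple of \<open>f\<close> would factor through \<open>g\<close>, hence be a multiple
  of \<open>g\<close>, against independence
  (\<open>independent_residue_homs_attain_coordinate\<close>). So there are units \<open>x\<close>, \<open>y\<close> at which \<open>(f, g)\<close>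
  takes the values \<open>(l ^ a, 0)\<close> and \<open>(0, l ^ b)\<close>, and they generate the units modulo \<open>T\<close>.

  As \<open>-1\<close> lies in \<open>T\<close>, the Steinberg relation makes symbols alternating (\<open>symbol_self\<close>). Hence,
  with \<open>f u = l ^ a i\<close>, \<open>g u = l ^ b j\<close>, \<open>f v = l ^ a k\<close>, \<open>g v = l ^ b m\<close>, the symbol \<open>{u, v}\<close> is the
  power of \<open>{x, y}\<close> with exponent \<open>i m - j k\<close> (\<open>symbol_of_products\<close>), while the determinant
  \<open>f u g v - f v g u\<close> is \<open>l ^ (a + b)\<close> times that same exponent. In particular \<open>Q\<close> is cyclic, generated
  by \<open>{x, y}\<close>, which therefore has order \<open>l ^ (n - c)\<close>. The two implications compare these two facts.

  \<^item> If \<open>f\<close> and \<open>g\<close> form a C-pair, the determinant kills the Steinberg relations and so defines a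
    homomorphism from \<open>Q\<close> to the residues modulo \<open>N\<close> (\<open>determinant_hom\<close>). It sends \<open>{x, y}\<close> to
    \<open>l ^ (a + b)\<close>. The order of \<open>Q\<close> annihilates the image, so \<open>N\<close> divides \<open>l ^ (n - c + a + b)\<close>.
  \<^item> Conversely, \<open>{z, 1 - z}\<close> is trivial in \<open>Q\<close>, so its exponent is divisible by \<open>l ^ (n - c)\<close>. If
    \<open>c \<le> a + b\<close>, the determinant at \<open>(z, 1 - z)\<close> is then divisible by \<open>N\<close>, for every \<open>z\<close>: this is
    the C-pair condition.
\<close>

section \<open>Quotients by generated subgroups\<close>

lemma (in comm_group) Mod_generate:
  assumes "S \<subseteq> carrier G"
  shows "generate G S \<lhd> G" "comm_group (G Mod generate G S)"
    "(\<lambda>x. generate G S #> x) \<in> hom G (G Mod generate G S)"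
    "\<And>s. s \<in> S \<Longrightarrow> generate G S #> s = \<one>\<^bsub>G Mod generate G S\<^esub>"
proof -
  have sub: "subgroup (generate G S) G"
    by (rule generate_is_subgroup[OF assms])
  then show N: "generate G S \<lhd> G"
    by (simp add: normal_iff_subgroup)
  show "comm_group (G Mod generate G S)"
    by (rule abelian_FactGroup[OF sub])
  show "(\<lambda>x. generate G S #> x) \<in> hom G (G Mod generate G S)"
    by (rule normal.r_coset_hom_Mod[OF N])
  show "generate G S #> s = \<one>\<^bsub>G Mod generate G S\<^esub>" if "s \<in> S" for s
    using coset_join2[OF _ sub, of s] generate.incl[OF that] assms that by auto
qed

lemma (in comm_group) Mod_generate_universal:
  assumes "S \<subseteq> carrier G" "group P" "h \<in> hom G P" "\<And>s. s \<in> S \<Longrightarrow> h s = \<one>\<^bsub>P\<^esub>"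
  obtains k where "k \<in> hom (G Mod generate G S) P"
    "\<And>x. x \<in> carrier G \<Longrightarrow> k (generate G S #> x) = h x"
proof -
  interpret h: group_hom G P h
    using assms(2,3) by (simp add: group_hom_def group_hom_axioms_def)
  have "generate G S \<subseteq> kernel G P h"
    by (rule generate_subgroup_incl[OF _ h.subgroup_kernel])
       (use assms in \<open>auto simp: kernel_def\<close>)
  then show thesis
    using h.FactGroup_universal_kernel[OF Mod_generate(1)[OF assms(1)]] that by blast
qed

section \<open>Tensor products of commutative groups\<close>

lemma tensor_relations_in_carrier:
  fixes G :: "('a, 'c) monoid_scheme" and H :: "('b, 'd) monoid_scheme"
  assumes "group G" "group H"
  shows "tensor_relations G H \<subseteq> carrier (free_Abelian_group (carrier G \<times> carrier H))"
proof -
  interpret G: group G by fact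
  interpret H: group H by fact
  have key: "frag_of p - frag_of q - frag_of r \<in> carrier (free_Abelian_group X)"
    if "p \<in> X" "q \<in> X" "r \<in> X" for p q r and X :: "('a \<times> 'b) set"
    using keys_diff[of "frag_of p - frag_of q" "frag_of r"] keys_diff[of "frag_of p" "frag_of q"] that
    by auto
  show ?thesis
    unfolding tensor_relations_def
    by (auto simp del: carrier_free_Abelian_group_iff intro!: key)
qed

context
  fixes G :: "('a, 'c) monoid_scheme" and H :: "('b, 'd) monoid_scheme"
  assumes G: "comm_group G" and H: "comm_group H"
begin

interpretation G: comm_group G by (rule G)
interpretation H: comm_group H by (rule H)
interpretation F: comm_group "free_Abelian_group (carrier G \<times> carrier H)"
  by (rule abelian_free_Abelian_group)

lemmas tensor_relations_closed = tensor_relations_in_carrier[OF G.is_group H.is_group]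

lemma tensor_product_comm_group: "comm_group (tensor_product G H)"
  unfolding tensor_product_def tensor_kernel_def
  by (rule F.Mod_generate(2)[OF tensor_relations_closed])

lemma tensor_projection_hom:
  "(\<lambda>c. tensor_kernel G H #>\<^bsub>free_Abelian_group (carrier G \<times> carrier H)\<^esub> c)
     \<in> hom (free_Abelian_group (carrier G \<times> carrier H)) (tensor_product G H)"
  unfolding tensor_product_def tensor_kernel_def
  by (rule F.Mod_generate(3)[OF tensor_relations_closed])

lemma pure_tensor_closed:
  assumes "x \<in> carrier G" "y \<in> carrier H"
  shows "pure_tensor G H x y \<in> carrier (tensor_product G H)"
  using hom_in_carrier[OF tensor_projection_hom, of "frag_of (x, y)"] assms
  by (simp add: pure_tensor_def)

text \<open>
  Both kinds of defining relations have the form \<open>p - q - r\<close> with \<open>p\<close>, \<open>q\<close>, \<open>r\<close> pairs, so additivity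
  of pure tensors in either argument is the same computation in the quotient.
\<close>

lemma tensor_relation_split:
  assumes "frag_of p - frag_of q - frag_of r \<in> tensor_relations G H"
    and "p \<in> carrier G \<times> carrier H" "q \<in> carrier G \<times> carrier H" "r \<in> carrier G \<times> carrier H"
  shows "pure_tensor G H (fst p) (snd p) =
    pure_tensor G H (fst q) (snd q) \<otimes>\<^bsub>tensor_product G H\<^esub> pure_tensor G H (fst r) (snd r)"
proof -
  interpret P: comm_group "tensor_product G H" by (rule tensor_product_comm_group)
  interpret \<pi>: group_hom "free_Abelian_group (carrier G \<times> carrier H)" "tensor_product G H"
    "\<lambda>c. tensor_kernel G H #>\<^bsub>free_Abelian_group (carrier G \<times> carrier H)\<^esub> c"
    by (intro group_hom.intro group_hom_axioms.intro tensor_projection_hom) auto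
  let ?\<pi> = "\<lambda>c. tensor_kernel G H #>\<^bsub>free_Abelian_group (carrier G \<times> carrier H)\<^esub> c"
  have 1: "?\<pi> (frag_of p - frag_of q - frag_of r) = \<one>\<^bsub>tensor_product G H\<^esub>"
    using F.Mod_generate(4)[OF tensor_relations_closed assms(1)]
    by (simp add: tensor_product_def tensor_kernel_def)
  have eq: "frag_of p = (frag_of p - frag_of q - frag_of r) + (frag_of q + frag_of r)"
    by simp
  have c: "frag_of p - frag_of q - frag_of r \<in> carrier (free_Abelian_group (carrier G \<times> carrier H))"
    using assms(1) tensor_relations_closed by blast
  have c': "frag_of q + frag_of r \<in> carrier (free_Abelian_group (carrier G \<times> carrier H))"
    using F.m_closed[of "frag_of q" "frag_of r"] assms(3,4) by simp
  have "?\<pi> (frag_of p) = ?\<pi> (frag_of q + frag_of r)"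
    using \<pi>.hom_mult[OF c c'] 1 \<pi>.hom_closed[OF c'] by (simp del: carrier_free_Abelian_group_iff)
  also have "\<dots> = ?\<pi> (frag_of q) \<otimes>\<^bsub>tensor_product G H\<^esub> ?\<pi> (frag_of r)"
    using \<pi>.hom_mult[of "frag_of q" "frag_of r"] assms(3,4) by simp
  finally show ?thesis by (simp add: pure_tensor_def)
qed

lemma pure_tensor_mult_left:
  assumes "x \<in> carrier G" "x' \<in> carrier G" "y \<in> carrier H"
  shows "pure_tensor G H (x \<otimes>\<^bsub>G\<^esub> x') y =
    pure_tensor G H x y \<otimes>\<^bsub>tensor_product G H\<^esub> pure_tensor G H x' y"
proof -
  have "frag_of (x \<otimes>\<^bsub>G\<^esub> x', y) - frag_of (x, y) - frag_of (x', y) \<in> tensor_relations G H"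
    using assms unfolding tensor_relations_def by blast
  from tensor_relation_split[OF this] assms show ?thesis by simp
qed

lemma pure_tensor_mult_right:
  assumes "x \<in> carrier G" "y \<in> carrier H" "y' \<in> carrier H"
  shows "pure_tensor G H x (y \<otimes>\<^bsub>H\<^esub> y') =
    pure_tensor G H x y \<otimes>\<^bsub>tensor_product G H\<^esub> pure_tensor G H x y'"
proof -
  have "frag_of (x, y \<otimes>\<^bsub>H\<^esub> y') - frag_of (x, y) - frag_of (x, y') \<in> tensor_relations G H"
    using assms unfolding tensor_relations_def by blast
  from tensor_relation_split[OF this] assms show ?thesis by simp
qed

text \<open>
  Pure tensors generate, because the pairs generate the free abelian group.
\<close>

lemma tensor_product_subgroup_eq:
  assumes "subgroup J (tensor_product G H)"
    and "\<And>x y. x \<in> carrier G \<Longrightarrow> y \<in> carrier H \<Longrightarrow> pure_tensor G H x y \<in> J"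
  shows "J = carrier (tensor_product G H)"
proof
  interpret P: comm_group "tensor_product G H" by (rule tensor_product_comm_group)
  let ?F = "free_Abelian_group (carrier G \<times> carrier H)"
  interpret \<pi>: group_hom ?F "tensor_product G H" "\<lambda>c. tensor_kernel G H #>\<^bsub>?F\<^esub> c"
    by (intro group_hom.intro group_hom_axioms.intro tensor_projection_hom) auto
  interpret J: subgroup J "tensor_product G H" by (rule assms(1))
  have "tensor_kernel G H #>\<^bsub>?F\<^esub> c \<in> J" if "Poly_Mapping.keys c \<subseteq> carrier G \<times> carrier H" for c
  proof (rule free_Abelian_group_induct[OF that])
    show "tensor_kernel G H #>\<^bsub>?F\<^esub> 0 \<in> J" using \<pi>.hom_one J.one_closed by simp
  next
    fix x y
    assume xy: "Poly_Mapping.keys x \<subseteq> carrier G \<times> carrier H" "Poly_Mapping.keys y \<subseteq> carrier G \<times> carrier H"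
      and J: "tensor_kernel G H #>\<^bsub>?F\<^esub> x \<in> J" "tensor_kernel G H #>\<^bsub>?F\<^esub> y \<in> J"
    have "tensor_kernel G H #>\<^bsub>?F\<^esub> (x \<otimes>\<^bsub>?F\<^esub> inv\<^bsub>?F\<^esub> y) \<in> J"
      using J xy F.inv_closed[of y] \<pi>.hom_mult[of x "inv\<^bsub>?F\<^esub> y"] \<pi>.hom_inv[of y]
      by (metis J.m_closed J.m_inv_closed carrier_free_Abelian_group_iff)
    then show "tensor_kernel G H #>\<^bsub>?F\<^esub> (x - y) \<in> J"
      using xy by simp
  next
    fix p assume "p \<in> carrier G \<times> carrier H"
    then show "tensor_kernel G H #>\<^bsub>?F\<^esub> frag_of p \<in> J"
      using assms(2)[of "fst p" "snd p"] by (auto simp: pure_tensor_def)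
  qed
  then show "carrier (tensor_product G H) \<subseteq> J"
    by (auto simp: tensor_product_def carrier_FactGroup)
  show "J \<subseteq> carrier (tensor_product G H)" by (rule J.subset)
qed

text \<open>
  A bilinear map extends to the free abelian group on pairs, where it kills the defining relations.
\<close>

lemma tensor_product_universal:
  assumes "comm_group P"
    and "\<And>x y. x \<in> carrier G \<Longrightarrow> y \<in> carrier H \<Longrightarrow> \<beta> x y \<in> carrier P"
    and "\<And>x x' y. x \<in> carrier G \<Longrightarrow> x' \<in> carrier G \<Longrightarrow> y \<in> carrier H \<Longrightarrow>
           \<beta> (x \<otimes>\<^bsub>G\<^esub> x') y = \<beta> x y \<otimes>\<^bsub>P\<^esub> \<beta> x' y"
    and "\<And>x y y'. x \<in> carrier G \<Longrightarrow> y \<in> carrier H \<Longrightarrow> y' \<in> carrier H \<Longrightarrow>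
           \<beta> x (y \<otimes>\<^bsub>H\<^esub> y') = \<beta> x y \<otimes>\<^bsub>P\<^esub> \<beta> x y'"
  obtains k where "k \<in> hom (tensor_product G H) P"
    "\<And>x y. x \<in> carrier G \<Longrightarrow> y \<in> carrier H \<Longrightarrow> k (pure_tensor G H x y) = \<beta> x y"
proof -
  let ?F = "free_Abelian_group (carrier G \<times> carrier H)"
  interpret P: comm_group P by fact
  have "(\<lambda>(x, y). \<beta> x y) ` (carrier G \<times> carrier H) \<subseteq> carrier P"
    using assms(2) by auto
  then obtain h where h: "h \<in> hom ?F P"
    and h_of: "\<And>p. p \<in> carrier G \<times> carrier H \<Longrightarrow> h (frag_of p) = (\<lambda>(x, y). \<beta> x y) p"
    by (rule P.free_Abelian_group_universal) blast
  interpret h: group_hom ?F P h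
    using h by (intro group_hom.intro group_hom_axioms.intro) auto
  have diff: "h (frag_of p - frag_of q - frag_of r) = \<one>\<^bsub>P\<^esub>"
    if "p \<in> carrier G \<times> carrier H" "q \<in> carrier G \<times> carrier H" "r \<in> carrier G \<times> carrier H"
      "h (frag_of p) = h (frag_of q) \<otimes>\<^bsub>P\<^esub> h (frag_of r)" for p q r
  proof -
    have c: "frag_of p \<in> carrier ?F" "frag_of q \<in> carrier ?F" "frag_of r \<in> carrier ?F"
      using that by auto
    have "frag_of p - frag_of q - frag_of r =
        frag_of p \<otimes>\<^bsub>?F\<^esub> inv\<^bsub>?F\<^esub> (frag_of q \<otimes>\<^bsub>?F\<^esub> frag_of r)"
      using F.m_closed[OF c(2,3)] by simp
    also have "h \<dots> = h (frag_of p) \<otimes>\<^bsub>P\<^esub> inv\<^bsub>P\<^esub> (h (frag_of q) \<otimes>\<^bsub>P\<^esub> h (frag_of r))"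
      using c by (simp only: h.hom_mult h.hom_inv F.m_closed F.inv_closed)
    also have "\<dots> = \<one>\<^bsub>P\<^esub>"
      using that(4) h.hom_closed[OF c(1)] by (metis P.r_inv)
    finally show ?thesis .
  qed
  have rel: "h s = \<one>\<^bsub>P\<^esub>" if "s \<in> tensor_relations G H" for s
    using that by (auto simp: tensor_relations_def h_of assms(3,4) intro!: diff)
  show thesis
  proof (rule F.Mod_generate_universal[OF tensor_relations_closed P.is_group h rel], assumption)
    fix k assume k: "k \<in> hom (?F Mod generate ?F (tensor_relations G H)) P"
      "\<And>x. x \<in> carrier ?F \<Longrightarrow> k (generate ?F (tensor_relations G H) #>\<^bsub>?F\<^esub> x) = h x"
    show thesis
      by (rule that[of k])
         (use k h_of in \<open>auto simp: tensor_product_def pure_tensor_def tensor_kernel_def\<close>)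
  qed
qed

end

section \<open>Symbols in the Milnor K-group modulo a subgroup\<close>

locale K2M_quotient = field K for K (structure) +
  fixes T :: "'a set"
  assumes T_subgroup: "subgroup T (units_of K)"
    and minus_one_in_T: "\<ominus> \<one> \<in> T"
begin

abbreviation "U \<equiv> units_of K"
abbreviation "A \<equiv> units_of K Mod T"
abbreviation "Q \<equiv> K2M_mod K T"

definition steinberg :: "('a set \<times> 'a set \<Rightarrow>\<^sub>0 int) set set"
  where "steinberg = {pure_tensor A A (T #>\<^bsub>U\<^esub> x) (T #>\<^bsub>U\<^esub> y) | x y.
    x \<in> Units K \<and> y \<in> Units K \<and> \<one> \<in> (T #>\<^bsub>U\<^esub> x) <+> (T #>\<^bsub>U\<^esub> y)}"

definition symbol :: "'a \<Rightarrow> 'a \<Rightarrow> ('a set \<times> 'a set \<Rightarrow>\<^sub>0 int) set set"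
  where "symbol x y = generate (tensor_product A A) steinberg
    #>\<^bsub>tensor_product A A\<^esub> pure_tensor A A (T #>\<^bsub>U\<^esub> x) (T #>\<^bsub>U\<^esub> y)"

sublocale U: comm_group U
  rewrites "carrier U = Units K" and "monoid.mult U = monoid.mult K" and "one U = one K"
  by (simp_all add: units_comm_group units_of_carrier units_of_mult units_of_one)

lemma T_normal: "T \<lhd> U"
  using T_subgroup by (simp add: U.normal_iff_subgroup)

lemma A_comm_group: "comm_group A"
  by (rule U.abelian_FactGroup[OF T_subgroup])

sublocale A: comm_group A
  by (rule A_comm_group)

sublocale TP: comm_group "tensor_product A A"
  by (rule tensor_product_comm_group[OF A_comm_group A_comm_group])

lemma K2M_mod_eq: "Q = tensor_product A A Mod generate (tensor_product A A) steinberg"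
  by (simp add: K2M_mod_def steinberg_def Let_def)

lemma coset_hom: "(\<lambda>x. T #>\<^bsub>U\<^esub> x) \<in> hom U A"
  by (rule normal.r_coset_hom_Mod[OF T_normal])

lemma coset_closed: "x \<in> Units K \<Longrightarrow> T #>\<^bsub>U\<^esub> x \<in> carrier A"
  using hom_in_carrier[OF coset_hom, of x] by (simp add: units_of_carrier)

lemma coset_mult: "x \<in> Units K \<Longrightarrow> y \<in> Units K \<Longrightarrow>
    T #>\<^bsub>U\<^esub> (x \<otimes> y) = (T #>\<^bsub>U\<^esub> x) \<otimes>\<^bsub>A\<^esub> (T #>\<^bsub>U\<^esub> y)"
  using hom_mult[OF coset_hom, of x y] by (simp add: units_of_carrier units_of_mult)

lemma steinberg_closed: "steinberg \<subseteq> carrier (tensor_product A A)"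
  unfolding steinberg_def
  using pure_tensor_closed[OF A_comm_group A_comm_group] coset_closed by auto

sublocale Q: comm_group Q
  unfolding K2M_mod_eq by (rule TP.Mod_generate(2)[OF steinberg_closed])

lemma Q_projection_hom:
  "(\<lambda>t. generate (tensor_product A A) steinberg #>\<^bsub>tensor_product A A\<^esub> t) \<in> hom (tensor_product A A) Q"
  unfolding K2M_mod_eq by (rule TP.Mod_generate(3)[OF steinberg_closed])

lemma tensor_coset_closed: "x \<in> Units K \<Longrightarrow> y \<in> Units K \<Longrightarrow>
    pure_tensor A A (T #>\<^bsub>U\<^esub> x) (T #>\<^bsub>U\<^esub> y) \<in> carrier (tensor_product A A)"
  by (intro pure_tensor_closed[OF A_comm_group A_comm_group] coset_closed)

lemma symbol_closed: "x \<in> Units K \<Longrightarrow> y \<in> Units K \<Longrightarrow> symbol x y \<in> carrier Q"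
  unfolding symbol_def by (intro hom_in_carrier[OF Q_projection_hom] tensor_coset_closed)

lemma symbol_mult_left: "x \<in> Units K \<Longrightarrow> x' \<in> Units K \<Longrightarrow> y \<in> Units K \<Longrightarrow>
    symbol (x \<otimes> x') y = symbol x y \<otimes>\<^bsub>Q\<^esub> symbol x' y"
  unfolding symbol_def
  by (simp add: coset_mult coset_closed pure_tensor_mult_left[OF A_comm_group A_comm_group]
      hom_mult[OF Q_projection_hom] tensor_coset_closed del: mult_FactGroup)

lemma symbol_mult_right: "x \<in> Units K \<Longrightarrow> y \<in> Units K \<Longrightarrow> y' \<in> Units K \<Longrightarrow>
    symbol x (y \<otimes> y') = symbol x y \<otimes>\<^bsub>Q\<^esub> symbol x y'"
  unfolding symbol_def
  by (simp add: coset_mult coset_closed pure_tensor_mult_right[OF A_comm_group A_comm_group]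
      hom_mult[OF Q_projection_hom] tensor_coset_closed del: mult_FactGroup)

lemma symbol_hom_left: "y \<in> Units K \<Longrightarrow> (\<lambda>x. symbol x y) \<in> hom U Q"
  by (rule homI) (auto simp: units_of_carrier units_of_mult symbol_closed symbol_mult_left)

lemma symbol_hom_right: "x \<in> Units K \<Longrightarrow> (\<lambda>y. symbol x y) \<in> hom U Q"
  by (rule homI) (auto simp: units_of_carrier units_of_mult symbol_closed symbol_mult_right)

lemma T_coset:
  assumes "t \<in> T" shows "T #>\<^bsub>U\<^esub> t = T #>\<^bsub>U\<^esub> \<one>"
  using U.coset_join2[OF _ T_subgroup, of t] U.coset_join2[OF _ T_subgroup, of \<one>]
    subgroup.subset[OF T_subgroup] subgroup.one_closed[OF T_subgroup] assms
  by (auto simp: units_of_carrier units_of_one)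

lemma symbol_T_left:
  assumes "t \<in> T" "y \<in> Units K" shows "symbol t y = \<one>\<^bsub>Q\<^esub>"
proof -
  have "symbol t y = symbol \<one> y" by (simp add: symbol_def T_coset[OF assms(1)])
  also have "\<dots> = \<one>\<^bsub>Q\<^esub>"
    using hom_one[OF symbol_hom_left[OF assms(2)]] by (simp add: units_of_one)
  finally show ?thesis .
qed

lemma symbol_T_right:
  assumes "x \<in> Units K" "t \<in> T" shows "symbol x t = \<one>\<^bsub>Q\<^esub>"
proof -
  have "symbol x t = symbol x \<one>" by (simp add: symbol_def T_coset[OF assms(2)])
  also have "\<dots> = \<one>\<^bsub>Q\<^esub>"
    using hom_one[OF symbol_hom_right[OF assms(1)]] by (simp add: units_of_one)
  finally show ?thesis .
qed

lemma one_minus_unit: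
  assumes "x \<in> carrier K" "x \<noteq> \<one>" shows "\<one> \<ominus> x \<in> Units K"
  using assms by (auto simp: field_Units)

lemma symbol_steinberg:
  assumes "x \<in> carrier K" "x \<noteq> \<zero>" "x \<noteq> \<one>"
  shows "symbol x (\<one> \<ominus> x) = \<one>\<^bsub>Q\<^esub>"
proof -
  have u: "x \<in> Units K" "\<one> \<ominus> x \<in> Units K"
    using assms one_minus_unit by (auto simp: field_Units)
  have "z \<in> T #>\<^bsub>U\<^esub> z" if "z \<in> Units K" for z
    using U.rcos_self[OF _ T_subgroup, of z] that by (simp add: units_of_carrier)
  moreover have "\<one> = x \<oplus> (\<one> \<ominus> x)"
    using assms(1) by algebra
  ultimately have "\<one> \<in> (T #>\<^bsub>U\<^esub> x) <+> (T #>\<^bsub>U\<^esub> (\<one> \<ominus> x))"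
    using u by (auto simp: set_add_def set_mult_def)
  then have "pure_tensor A A (T #>\<^bsub>U\<^esub> x) (T #>\<^bsub>U\<^esub> (\<one> \<ominus> x)) \<in> steinberg"
    using u unfolding steinberg_def by blast
  then show ?thesis
    unfolding symbol_def K2M_mod_eq by (rule TP.Mod_generate(4)[OF steinberg_closed])
qed

text \<open>
  For \<open>x \<noteq> 1\<close>, dividing \<open>1 - x\<close> by \<open>1 - 1/x\<close> gives \<open>-x\<close>. The symbols of \<open>x\<close> with \<open>1 - x\<close> and, since
  \<open>{x, v}\<close> is inverse to \<open>{1/x, v}\<close>, with \<open>1 - 1/x\<close> are trivial. So \<open>{x, -x}\<close> is trivial, and modulo
  \<open>T\<close> the sign does not matter.
\<close>

lemma symbol_self:
  assumes x: "x \<in> Units K" shows "symbol x x = \<one>\<^bsub>Q\<^esub>"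
proof (cases "x = \<one>")
  case True
  then show ?thesis using symbol_T_left[of \<one> x] x subgroup.one_closed[OF T_subgroup]
    by (simp add: units_of_one)
next
  case False
  have xc: "x \<in> carrier K" and x0: "x \<noteq> \<zero>" using x by (auto simp: field_Units)
  define y where "y = inv x"
  have y: "y \<in> Units K" "y \<in> carrier K" and xy: "x \<otimes> y = \<one>"
    using x by (auto simp: y_def)
  have y0: "y \<noteq> \<zero>" using y(1) by (auto simp: field_Units)
  have y1: "y \<noteq> \<one>" using xy xc False by auto
  define u where "u = \<one> \<ominus> x"
  define v where "v = \<one> \<ominus> y"
  have u: "u \<in> Units K" and v: "v \<in> Units K"
    using one_minus_unit xc False y y1 by (auto simp: u_def v_def)
  have m: "\<ominus> \<one> \<in> Units K"
    using minus_one_in_T subgroup.subset[OF T_subgroup] by (auto simp: units_of_carrier)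
  have uv: "u = (\<ominus> \<one> \<otimes> x) \<otimes> v"
  proof -
    have "(\<ominus> \<one> \<otimes> x) \<otimes> v = \<ominus> x \<oplus> x \<otimes> y"
      unfolding v_def using xc y(2) by algebra
    then show ?thesis unfolding u_def xy using xc by algebra
  qed
  have s1: "symbol x u = \<one>\<^bsub>Q\<^esub>" unfolding u_def by (rule symbol_steinberg[OF xc x0 False])
  have s2: "symbol y v = \<one>\<^bsub>Q\<^esub>" unfolding v_def by (rule symbol_steinberg[OF y(2) y0 y1])
  have "symbol x v \<otimes>\<^bsub>Q\<^esub> symbol y v = symbol (x \<otimes> y) v"
    by (rule symbol_mult_left[symmetric, OF x y(1) v])
  also have "\<dots> = \<one>\<^bsub>Q\<^esub>"
    unfolding xy using symbol_T_left[OF _ v] subgroup.one_closed[OF T_subgroup] by (simp add: units_of_one)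
  finally have s3: "symbol x v = \<one>\<^bsub>Q\<^esub>"
    using s2 symbol_closed[OF x v] by simp
  have "symbol x u = (symbol x (\<ominus> \<one>) \<otimes>\<^bsub>Q\<^esub> symbol x x) \<otimes>\<^bsub>Q\<^esub> symbol x v"
    unfolding uv using x v m by (simp add: symbol_mult_right)
  then show ?thesis
    using s1 s3 symbol_T_right[OF x minus_one_in_T] symbol_closed[OF x x] by simp
qed

text \<open>
  The polarisation of \<open>symbol_self\<close>.
\<close>

lemma symbol_antisym:
  assumes x: "x \<in> Units K" and y: "y \<in> Units K"
  shows "symbol y x = inv\<^bsub>Q\<^esub> symbol x y"
proof -
  have "symbol (x \<otimes> y) (x \<otimes> y) =
      (symbol x x \<otimes>\<^bsub>Q\<^esub> symbol y x) \<otimes>\<^bsub>Q\<^esub> (symbol x y \<otimes>\<^bsub>Q\<^esub> symbol y y)"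
    using x y by (simp add: symbol_mult_left symbol_mult_right)
  then have "symbol y x \<otimes>\<^bsub>Q\<^esub> symbol x y = \<one>\<^bsub>Q\<^esub>"
    using x y by (simp add: symbol_closed symbol_self)
  then show ?thesis
    using x y by (simp add: Q.inv_equality symbol_closed)
qed

lemma K2M_mod_subgroup_eq:
  assumes J: "subgroup J Q" and sym: "\<And>x y. x \<in> Units K \<Longrightarrow> y \<in> Units K \<Longrightarrow> symbol x y \<in> J"
  shows "J = carrier Q"
proof
  let ?\<pi> = "\<lambda>t. generate (tensor_product A A) steinberg #>\<^bsub>tensor_product A A\<^esub> t"
  interpret \<pi>: group_hom "tensor_product A A" Q ?\<pi>
    by (intro group_hom.intro group_hom_axioms.intro Q_projection_hom) auto
  interpret J: subgroup J Q by fact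
  have "subgroup {t \<in> carrier (tensor_product A A). ?\<pi> t \<in> J} (tensor_product A A)"
    by (rule subgroup.intro) (use J.one_closed in auto)
  then have "{t \<in> carrier (tensor_product A A). ?\<pi> t \<in> J} = carrier (tensor_product A A)"
  proof (rule tensor_product_subgroup_eq[OF A_comm_group A_comm_group])
    fix X Y assume "X \<in> carrier A" "Y \<in> carrier A"
    then obtain x y where "x \<in> Units K" "y \<in> Units K" "X = T #>\<^bsub>U\<^esub> x" "Y = T #>\<^bsub>U\<^esub> y"
      by (auto simp: carrier_FactGroup units_of_carrier)
    then show "pure_tensor A A X Y \<in> {t \<in> carrier (tensor_product A A). ?\<pi> t \<in> J}"
      using sym by (auto simp: symbol_def tensor_coset_closed)
  qed
  then show "carrier Q \<subseteq> J"
    by (auto simp: K2M_mod_eq carrier_FactGroup)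
  show "J \<subseteq> carrier Q" by (rule J.subset)
qed

text \<open>
  The map is given on units and not on cosets, which is how determinants of homomorphisms arise.
  The relation \<open>1 \<in> xT + yT\<close> gives \<open>1 = tx + sy\<close> with \<open>s\<close>, \<open>t\<close> in \<open>T\<close>. As \<open>\<beta>\<close> ignores factors in \<open>T\<close>,
  its value at \<open>(x, y)\<close> is its value at \<open>(tx, 1 - tx)\<close>, so the conditions on \<open>z\<close> and \<open>1 - z\<close>
  already account for all the relations.
\<close>

lemma K2M_mod_universal:
  assumes P: "comm_group P"
    and closed: "\<And>x y. x \<in> Units K \<Longrightarrow> y \<in> Units K \<Longrightarrow> \<beta> x y \<in> carrier P"
    and left: "\<And>x x' y. x \<in> Units K \<Longrightarrow> x' \<in> Units K \<Longrightarrow> y \<in> Units K \<Longrightarrow>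
           \<beta> (x \<otimes> x') y = \<beta> x y \<otimes>\<^bsub>P\<^esub> \<beta> x' y"
    and right: "\<And>x y y'. x \<in> Units K \<Longrightarrow> y \<in> Units K \<Longrightarrow> y' \<in> Units K \<Longrightarrow>
           \<beta> x (y \<otimes> y') = \<beta> x y \<otimes>\<^bsub>P\<^esub> \<beta> x y'"
    and T_left: "\<And>t y. t \<in> T \<Longrightarrow> y \<in> Units K \<Longrightarrow> \<beta> t y = \<one>\<^bsub>P\<^esub>"
    and T_right: "\<And>x t. x \<in> Units K \<Longrightarrow> t \<in> T \<Longrightarrow> \<beta> x t = \<one>\<^bsub>P\<^esub>"
    and steinberg: "\<And>x. x \<in> carrier K \<Longrightarrow> x \<noteq> \<zero> \<Longrightarrow> x \<noteq> \<one> \<Longrightarrow> \<beta> x (\<one> \<ominus> x) = \<one>\<^bsub>P\<^esub>"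
  obtains k where "k \<in> hom Q P"
    "\<And>x y. x \<in> Units K \<Longrightarrow> y \<in> Units K \<Longrightarrow> k (symbol x y) = \<beta> x y"
proof -
  interpret P: comm_group P by fact
  have T_units: "T \<subseteq> Units K"
    using subgroup.subset[OF T_subgroup] by (simp add: units_of_carrier)
  have coset_iff: "z \<in> T #>\<^bsub>U\<^esub> x \<longleftrightarrow> (\<exists>t\<in>T. z = t \<otimes> x)" for z x
    by (auto simp: r_coset_def units_of_mult)
  have inv: "\<beta> (t \<otimes> x) (s \<otimes> y) = \<beta> x y" if "t \<in> T" "s \<in> T" "x \<in> Units K" "y \<in> Units K" for t s x y
  proof -
    have "t \<in> Units K" "s \<in> Units K" using that T_units by auto
    then show ?thesis using that by (simp add: left right T_left T_right closed)
  qed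
  define rep where "rep X = (SOME x. x \<in> Units K \<and> X = T #>\<^bsub>U\<^esub> x)" for X
  have rep: "rep X \<in> Units K" "T #>\<^bsub>U\<^esub> rep X = X" if "X \<in> carrier A" for X
  proof -
    have "\<exists>x. x \<in> Units K \<and> X = T #>\<^bsub>U\<^esub> x"
      using that by (auto simp: carrier_FactGroup units_of_carrier)
    from someI_ex[OF this] show "rep X \<in> Units K" "T #>\<^bsub>U\<^esub> rep X = X"
      by (auto simp: rep_def)
  qed
  have self: "z \<in> T #>\<^bsub>U\<^esub> z" if "z \<in> Units K" for z
    using U.rcos_self[OF _ T_subgroup, of z] that by (simp add: units_of_carrier)
  have rep_coset: "\<beta> (rep (T #>\<^bsub>U\<^esub> x)) (rep (T #>\<^bsub>U\<^esub> y)) = \<beta> x y" if "x \<in> Units K" "y \<in> Units K" for x y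
  proof -
    have "\<exists>t\<in>T. rep (T #>\<^bsub>U\<^esub> z) = t \<otimes> z" if "z \<in> Units K" for z
      using rep[OF coset_closed[OF that]] self coset_iff by metis
    then show ?thesis using inv that by metis
  qed
  let ?\<gamma> = "\<lambda>X Y. \<beta> (rep X) (rep Y)"
  have cosetE: "\<exists>x. x \<in> Units K \<and> X = T #>\<^bsub>U\<^esub> x" if "X \<in> carrier A" for X
    using rep[OF that] by metis
  obtain h where h: "h \<in> hom (tensor_product A A) P"
    and h_of: "\<And>X Y. X \<in> carrier A \<Longrightarrow> Y \<in> carrier A \<Longrightarrow> h (pure_tensor A A X Y) = ?\<gamma> X Y"
  proof (rule tensor_product_universal[OF A_comm_group A_comm_group P, of ?\<gamma>])
    fix X Y assume "X \<in> carrier A" "Y \<in> carrier A"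
    then show "?\<gamma> X Y \<in> carrier P" by (simp add: closed rep)
  next
    fix X X' Y assume "X \<in> carrier A" "X' \<in> carrier A" "Y \<in> carrier A"
    then obtain x x' y where "x \<in> Units K" "X = T #>\<^bsub>U\<^esub> x" "x' \<in> Units K" "X' = T #>\<^bsub>U\<^esub> x'"
       "y \<in> Units K" "Y = T #>\<^bsub>U\<^esub> y"
      using cosetE by metis
    then show "?\<gamma> (X \<otimes>\<^bsub>A\<^esub> X') Y = ?\<gamma> X Y \<otimes>\<^bsub>P\<^esub> ?\<gamma> X' Y"
      by (simp add: coset_mult[symmetric] rep_coset left del: mult_FactGroup)
  next
    fix X Y Y' assume "X \<in> carrier A" "Y \<in> carrier A" "Y' \<in> carrier A"
    then obtain x y y' where "x \<in> Units K" "X = T #>\<^bsub>U\<^esub> x" "y' \<in> Units K" "Y' = T #>\<^bsub>U\<^esub> y'"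
       "y \<in> Units K" "Y = T #>\<^bsub>U\<^esub> y"
      using cosetE by metis
    then show "?\<gamma> X (Y \<otimes>\<^bsub>A\<^esub> Y') = ?\<gamma> X Y \<otimes>\<^bsub>P\<^esub> ?\<gamma> X Y'"
      by (simp add: coset_mult[symmetric] rep_coset right del: mult_FactGroup)
  qed blast
  have h_coset: "h (pure_tensor A A (T #>\<^bsub>U\<^esub> x) (T #>\<^bsub>U\<^esub> y)) = \<beta> x y" if "x \<in> Units K" "y \<in> Units K" for x y
    using that by (simp add: h_of coset_closed rep_coset)
  have kill: "h s = \<one>\<^bsub>P\<^esub>" if "s \<in> steinberg" for s
  proof -
    obtain x y where xy: "x \<in> Units K" "y \<in> Units K" "s = pure_tensor A A (T #>\<^bsub>U\<^esub> x) (T #>\<^bsub>U\<^esub> y)"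
      and "\<one> \<in> (T #>\<^bsub>U\<^esub> x) <+> (T #>\<^bsub>U\<^esub> y)"
      using \<open>s \<in> steinberg\<close> unfolding steinberg_def by blast
    then obtain t s' where ts: "t \<in> T" "s' \<in> T" "\<one> = (t \<otimes> x) \<oplus> (s' \<otimes> y)"
      by (auto simp: set_add_def set_mult_def coset_iff)
    have u: "t \<otimes> x \<in> Units K" "s' \<otimes> y \<in> Units K"
      using ts xy T_units by auto
    then have uc: "t \<otimes> x \<in> carrier K" "s' \<otimes> y \<in> carrier K" "t \<otimes> x \<noteq> \<zero>" "s' \<otimes> y \<noteq> \<zero>"
      by (auto simp: field_Units)
    have e: "s' \<otimes> y = \<one> \<ominus> (t \<otimes> x)"
      unfolding ts(3) using uc(1,2) by algebra
    then have ne: "t \<otimes> x \<noteq> \<one>" using uc by auto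
    have "h s = \<beta> (t \<otimes> x) (s' \<otimes> y)"
      using xy ts inv by (simp add: h_coset)
    also have "\<dots> = \<one>\<^bsub>P\<^esub>" unfolding e by (rule steinberg[OF uc(1,3) ne])
    finally show ?thesis .
  qed
  show thesis
  proof (rule TP.Mod_generate_universal[OF steinberg_closed P.is_group h kill], assumption)
    fix k assume k: "k \<in> hom (tensor_product A A Mod generate (tensor_product A A) steinberg) P"
      "\<And>x. x \<in> carrier (tensor_product A A) \<Longrightarrow>
         k (generate (tensor_product A A) steinberg #>\<^bsub>tensor_product A A\<^esub> x) = h x"
    show thesis
      by (rule that[of k])
         (use k h_coset in \<open>auto simp: K2M_mod_eq symbol_def tensor_coset_closed\<close>)
  qed
qed

text \<open>
  Symbols are bilinear and alternating, so on a group with two generators they are the determinant of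
  the exponents.
\<close>

lemma symbol_of_products:
  assumes x: "x \<in> Units K" and y: "y \<in> Units K" and "t \<in> T" "t' \<in> T"
  shows "symbol (t \<otimes> (x [^]\<^bsub>U\<^esub> i \<otimes> y [^]\<^bsub>U\<^esub> j)) (t' \<otimes> (x [^]\<^bsub>U\<^esub> k \<otimes> y [^]\<^bsub>U\<^esub> m))
    = symbol x y [^]\<^bsub>Q\<^esub> (i * m - j * k :: int)"
proof -
  have T: "t \<in> Units K" "t' \<in> Units K"
    using assms(3,4) subgroup.subset[OF T_subgroup] by (auto simp: units_of_carrier)
  have pow: "z [^]\<^bsub>U\<^esub> r \<in> Units K" if "z \<in> Units K" for z and r :: int
    using U.int_pow_closed[of z r] that by (simp add: units_of_carrier)
  have L: "symbol (z [^]\<^bsub>U\<^esub> r) w = symbol z w [^]\<^bsub>Q\<^esub> r" if "z \<in> Units K" "w \<in> Units K" for z w and r :: int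
    using hom_int_pow[OF symbol_hom_left[OF that(2)] _ U.is_group Q.is_group] that
    by (simp add: units_of_carrier)
  have R: "symbol w (z [^]\<^bsub>U\<^esub> r) = symbol w z [^]\<^bsub>Q\<^esub> r" if "z \<in> Units K" "w \<in> Units K" for z w and r :: int
    using hom_int_pow[OF symbol_hom_right[OF that(2)] _ U.is_group Q.is_group] that
    by (simp add: units_of_carrier)
  let ?w = "t' \<otimes> (x [^]\<^bsub>U\<^esub> k \<otimes> y [^]\<^bsub>U\<^esub> m)"
  have w: "?w \<in> Units K" using x y T pow by auto
  have q: "symbol x y \<in> carrier Q" by (rule symbol_closed[OF x y])
  have xw: "symbol x ?w = symbol x y [^]\<^bsub>Q\<^esub> m"
    using x y T assms(4) pow by (simp add: symbol_mult_right symbol_T_right R symbol_self symbol_closed)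
  have yw: "symbol y ?w = inv\<^bsub>Q\<^esub> symbol x y [^]\<^bsub>Q\<^esub> k"
    using x y T assms(4) pow
    by (simp add: symbol_mult_right symbol_T_right R symbol_self symbol_closed symbol_antisym[of x y])
  have "symbol (t \<otimes> (x [^]\<^bsub>U\<^esub> i \<otimes> y [^]\<^bsub>U\<^esub> j)) ?w =
      (symbol x y [^]\<^bsub>Q\<^esub> m) [^]\<^bsub>Q\<^esub> i \<otimes>\<^bsub>Q\<^esub> (inv\<^bsub>Q\<^esub> symbol x y [^]\<^bsub>Q\<^esub> k) [^]\<^bsub>Q\<^esub> j"
    using x y T assms(3) pow w
    by (simp add: symbol_mult_left symbol_T_left L xw yw symbol_closed)
  also have "\<dots> = symbol x y [^]\<^bsub>Q\<^esub> (i * m - j * k)"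
    using q by (simp add: Q.int_pow_pow Q.int_pow_inv Q.int_pow_diff mult.commute)
  finally show ?thesis .
qed

text \<open>
  The C-pair condition says exactly that the determinant vanishes on the Steinberg relations.
\<close>

lemma determinant_hom:
  fixes l n :: nat
  assumes l: "l > 0"
    and f: "f \<in> hom U (integer_mod_group (l ^ n))" and g: "g \<in> hom U (integer_mod_group (l ^ n))"
    and T: "\<And>t. t \<in> T \<Longrightarrow> f t = 0 \<and> g t = 0"
    and C: "\<And>x. x \<in> carrier K \<Longrightarrow> x \<noteq> \<zero> \<Longrightarrow> x \<noteq> \<one> \<Longrightarrow>
           [f (\<one> \<ominus> x) * g x = f x * g (\<one> \<ominus> x)] (mod int l ^ n)"
  obtains \<psi> where "\<psi> \<in> hom Q (integer_mod_group (l ^ n))"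
    "\<And>x y. x \<in> Units K \<Longrightarrow> y \<in> Units K \<Longrightarrow> \<psi> (symbol x y) = (f x * g y - f y * g x) mod int l ^ n"
proof -
  let ?N = "int l ^ n" and ?P = "integer_mod_group (l ^ n)"
  let ?\<beta> = "\<lambda>x y. (f x * g y - f y * g x) mod ?N"
  have add: "h (x \<otimes> y) = (h x + h y) mod ?N"
    if "h \<in> hom U ?P" "x \<in> Units K" "y \<in> Units K" for h x y
    using hom_mult[OF that(1), of x y] that by (simp add: units_of_carrier units_of_mult)
  have left: "?\<beta> (x \<otimes> x') y = (?\<beta> x y + ?\<beta> x' y) mod ?N"
    if "x \<in> Units K" "x' \<in> Units K" for x x' y
  proof -
    have "[f (x \<otimes> x') * g y - f y * g (x \<otimes> x') = (f x + f x') * g y - f y * (g x + g x')] (mod ?N)"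
      using that by (intro cong_diff cong_mult) (auto simp: add[OF f] add[OF g] cong_def)
    then show ?thesis by (simp add: cong_def mod_add_eq algebra_simps)
  qed
  \<comment> \<open>Additivity on the right is deduced from additivity on the left.\<close>
  have anti: "?\<beta> y x = (- ?\<beta> x y) mod ?N" for x y
    by (simp add: mod_minus_eq algebra_simps)
  show thesis
  proof (rule K2M_mod_universal[of ?P ?\<beta>])
    show "?\<beta> x (y \<otimes> y') = ?\<beta> x y \<otimes>\<^bsub>?P\<^esub> ?\<beta> x y'"
      if "x \<in> Units K" "y \<in> Units K" "y' \<in> Units K" for x y y'
    proof -
      have "?\<beta> x (y \<otimes> y') = (- ((?\<beta> y x + ?\<beta> y' x) mod ?N)) mod ?N"
        unfolding anti[of x "y \<otimes> y'"] left[OF that(2,3)] ..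
      also have "\<dots> = (- ?\<beta> y x + - ?\<beta> y' x) mod ?N"
        by (simp add: mod_minus_eq)
      also have "\<dots> = (?\<beta> x y + ?\<beta> x y') mod ?N"
        unfolding anti[of x y] anti[of x y'] by (simp add: mod_add_eq)
      finally show ?thesis by simp
    qed
    show "?\<beta> x (\<one> \<ominus> x) = \<one>\<^bsub>?P\<^esub>" if "x \<in> carrier K" "x \<noteq> \<zero>" "x \<noteq> \<one>" for x
      using C[OF that] by (simp add: cong_iff_dvd_diff dvd_diff_commute)
    show "?\<beta> x y \<in> carrier ?P" for x y
      using l by (simp add: carrier_integer_mod_group)
  qed (use left T that in auto)
qed

end

section \<open>Homomorphisms to residues modulo a prime power\<close>

text \<open>
  The values of \<open>h\<close> on \<open>H\<close> form a subgroup of the residues modulo \<open>l ^ n\<close>, and these are generated by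
  a power of \<open>l\<close>. The generator is the least positive integer \<open>d\<close> that is congruent to a value:
  remainders of values modulo \<open>d\<close> are again values, so they vanish.
\<close>

lemma (in group) residue_hom_attains_generator:
  fixes l n :: nat
  assumes l: "Factorial_Ring.prime l" and H: "subgroup H G"
    and h: "h \<in> hom G (integer_mod_group (l ^ n))"
  obtains e x where "e \<le> n" "x \<in> H" "[h x = int l ^ e] (mod int l ^ n)"
    "\<And>u. u \<in> H \<Longrightarrow> int l ^ e dvd h u"
proof -
  let ?N = "int l ^ n"
  interpret H: subgroup H G by fact
  interpret h: group_hom G "integer_mod_group (l ^ n)" h
    using h by (intro group_hom.intro group_hom_axioms.intro) auto
  have lpos: "l > 0" using l by (simp add: prime_gt_0_nat)
  have h_comb: "[h (u \<otimes> x [^] k) = h u + k * h x] (mod ?N)" if "u \<in> carrier G" "x \<in> carrier G"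
    for u x and k :: int
    using that by (simp add: h.hom_mult h.hom_int_pow int_pow_integer_mod_group cong_def mod_add_right_eq)
  define attained where "attained d \<longleftrightarrow> 0 < d \<and> (\<exists>x\<in>H. [h x = int d] (mod ?N))" for d :: nat
  have "attained (l ^ n)"
    unfolding attained_def using lpos H.one_closed
    by (intro conjI bexI[of _ \<one>]) (simp_all add: cong_def)
  then have least: "attained (LEAST d. attained d)" by (rule LeastI)
  define d where "d = (LEAST d. attained d)"
  obtain x where x: "x \<in> H" "[h x = int d] (mod ?N)" and d: "0 < d"
    using least by (auto simp: attained_def d_def)
  have minimal: "i mod int d = 0" if "u \<in> H" "[h u = i] (mod ?N)" for u i
  proof (rule ccontr)
    assume nz: "i mod int d \<noteq> 0"
    let ?v = "u \<otimes> x [^] (- (i div int d))"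
    have "[h ?v = h u + - (i div int d) * h x] (mod ?N)"
      by (rule h_comb[OF H.mem_carrier[OF that(1)] H.mem_carrier[OF x(1)]])
    also have "[h u + - (i div int d) * h x = i + - (i div int d) * int d] (mod ?N)"
      by (rule cong_add[OF that(2) cong_mult[OF cong_refl x(2)]])
    also have "i + - (i div int d) * int d = i mod int d"
      by (simp add: minus_div_mult_eq_mod)
    finally have c: "[h ?v = i mod int d] (mod ?N)" .
    have pos: "0 \<le> i mod int d" "i mod int d < int d" using d by auto
    have "?v \<in> H" by (rule H.m_closed[OF that(1) subgroup_int_pow_closed[OF H x(1)]])
    then have "attained (nat (i mod int d))"
      unfolding attained_def using c pos nz by auto
    then have "d \<le> nat (i mod int d)" unfolding d_def by (rule Least_le)
    then show False using pos by linarith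
  qed
  \<comment> \<open>The value at the identity is congruent to the modulus itself, so the modulus is a multiple of d.\<close>
  have "int d dvd ?N"
    using minimal[OF H.one_closed, of ?N] by (auto simp: cong_def)
  then have "d dvd l ^ n" by (simp flip: of_nat_power)
  then obtain e where e: "e \<le> n" "d = l ^ e"
    using divides_primepow_nat[OF l] by blast
  show thesis
  proof (rule that[OF e(1) x(1)])
    show "[h x = int l ^ e] (mod ?N)" using x(2) e(2) by simp
    show "int l ^ e dvd h u" if "u \<in> H" for u
      using minimal[OF that, of "h u"] e(2) by (auto simp: mod_eq_0_iff_dvd)
  qed
qed

lemma prime_power_dvd_iff_int:
  assumes "Factorial_Ring.prime (l :: nat)"
  shows "int l ^ i dvd int l ^ j \<longleftrightarrow> i \<le> j"
proof -
  have "1 < l" by (rule prime_gt_1_nat[OF assms])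
  then show ?thesis by (simp add: dvd_power_iff_le flip: of_nat_power)
qed

text \<open>
  The assumption \<open>ord\<close> says that \<open>h\<close> has order \<open>l ^ (n - a)\<close> in the group of homomorphisms. The generator
  \<open>l ^ e\<close> of the image has that same order, which forces \<open>e = a\<close>.
\<close>

lemma (in group) residue_hom_order:
  fixes l n a :: nat
  assumes l: "Factorial_Ring.prime l" and h: "h \<in> hom G (integer_mod_group (l ^ n))" and "a \<le> n"
    and ord: "\<And>r :: int. (\<forall>u\<in>carrier G. int l ^ n dvd r * h u) \<longleftrightarrow> int l ^ (n - a) dvd r"
  obtains x where "x \<in> carrier G" "[h x = int l ^ a] (mod int l ^ n)"
    "\<And>u. u \<in> carrier G \<Longrightarrow> int l ^ a dvd h u"
proof -
  obtain e x where e: "e \<le> n" and x: "x \<in> carrier G" "[h x = int l ^ e] (mod int l ^ n)"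
    and dvd: "\<And>u. u \<in> carrier G \<Longrightarrow> int l ^ e dvd h u"
    using residue_hom_attains_generator[OF l subgroup_self h] by metis
  have "int l ^ n dvd int l ^ (n - e) * h u" if "u \<in> carrier G" for u
    using mult_dvd_mono[OF dvd_refl[of "int l ^ (n - e)"] dvd[OF that]] e by (simp flip: power_add)
  then have "e \<le> a" using ord[of "int l ^ (n - e)"] e assms(3)
    by (auto simp: prime_power_dvd_iff_int[OF l])
  have "int l ^ n dvd int l ^ (n - a) * h x" using ord[of "int l ^ (n - a)"] x by auto
  moreover have "[int l ^ (n - a) * h x = int l ^ (n - a) * int l ^ e] (mod int l ^ n)"
    by (intro cong_mult x) auto
  ultimately have "int l ^ n dvd int l ^ (n - a + e)"
    by (simp add: cong_dvd_iff power_add)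
  then have "a \<le> e" using assms(3) by (simp add: prime_power_dvd_iff_int[OF l])
  with \<open>e \<le> a\<close> show thesis using that x dvd by auto
qed

text \<open>
  Let \<open>l ^ e\<close> generate the values of \<open>f\<close> on the kernel of \<open>g\<close>. Then \<open>l ^ (n - e) f\<close> vanishes on that
  kernel, so it factors through \<open>g\<close>, whose image is cyclic and generated by \<open>l ^ b\<close>. A
  homomorphism from that image to the residues is a multiplication by some \<open>m\<close>, hence
  \<open>l ^ (n - e) f = m g\<close>. By independence both sides vanish, and the order of \<open>f\<close> gives \<open>e \<le> a\<close>.
\<close>

lemma (in group) independent_residue_homs_attain_coordinate:
  fixes l n a b :: nat
  assumes l: "Factorial_Ring.prime l" and "a \<le> n" "b \<le> n"
    and f: "f \<in> hom G (integer_mod_group (l ^ n))" and g: "g \<in> hom G (integer_mod_group (l ^ n))"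
    and ord_f: "\<And>r :: int. (\<forall>u\<in>carrier G. int l ^ n dvd r * f u) \<longleftrightarrow> int l ^ (n - a) dvd r"
    and ord_g: "\<And>r :: int. (\<forall>u\<in>carrier G. int l ^ n dvd r * g u) \<longleftrightarrow> int l ^ (n - b) dvd r"
    and indep: "\<And>i j :: int. \<forall>u\<in>carrier G. int l ^ n dvd i * f u + j * g u \<Longrightarrow>
           \<forall>u\<in>carrier G. int l ^ n dvd i * f u"
  obtains x where "x \<in> carrier G" "[f x = int l ^ a] (mod int l ^ n)" "[g x = 0] (mod int l ^ n)"
proof -
  let ?N = "int l ^ n"
  have lpos: "l > 0" using l by (simp add: prime_gt_0_nat)
  interpret f: group_hom G "integer_mod_group (l ^ n)" f
    using f by (intro group_hom.intro group_hom_axioms.intro) auto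
  interpret g: group_hom G "integer_mod_group (l ^ n)" g
    using g by (intro group_hom.intro group_hom_axioms.intro) auto
  have f_comb: "[f (u \<otimes> x [^] k) = f u + k * f x] (mod ?N)" if "u \<in> carrier G" "x \<in> carrier G"
    for u x and k :: int
    using that by (simp add: f.hom_mult f.hom_int_pow int_pow_integer_mod_group cong_def mod_add_right_eq)
  have g_comb: "g (u \<otimes> x [^] k) = (g u + k * g x) mod ?N" if "u \<in> carrier G" "x \<in> carrier G"
    for u x and k :: int
    using that by (simp add: g.hom_mult g.hom_int_pow int_pow_integer_mod_group cong_def mod_add_right_eq)
  let ?H = "kernel G (integer_mod_group (l ^ n)) g"
  have dvd_f: "int l ^ a dvd f u" if "u \<in> carrier G" for u
    using residue_hom_order[OF l f assms(2) ord_f] that by blast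
  obtain y where y: "y \<in> carrier G" "[g y = int l ^ b] (mod ?N)"
    and dvd_g: "\<And>u. u \<in> carrier G \<Longrightarrow> int l ^ b dvd g u"
    using residue_hom_order[OF l g assms(3) ord_g] by blast
  obtain e x where e: "e \<le> n" and x: "x \<in> ?H" "[f x = int l ^ e] (mod ?N)"
    and dvd: "\<And>u. u \<in> ?H \<Longrightarrow> int l ^ e dvd f u"
    using residue_hom_attains_generator[OF l g.subgroup_kernel f] by metis
  have xG: "x \<in> carrier G" and gx: "g x = 0" using x(1) by (auto simp: kernel_def)
  have eN: "int l ^ e dvd ?N" using e by (rule le_imp_power_dvd)
  \<comment> \<open>Multiplying by a power of y moves u into the kernel of g, where f is divisible by l ^ e.\<close>
  have kill: "int l ^ e dvd f u + k * f y"
    if u: "u \<in> carrier G" and k: "[g u + k * int l ^ b = 0] (mod ?N)" for u k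
  proof -
    have "[g u + k * g y = g u + k * int l ^ b] (mod ?N)"
      using y(2) by (intro cong_add cong_mult) auto
    then have "[g u + k * g y = 0] (mod ?N)" using k by (rule cong_trans)
    then have "g (u \<otimes> y [^] k) = 0"
      unfolding g_comb[OF u y(1)] by (simp add: cong_def)
    then have "u \<otimes> y [^] k \<in> ?H"
      using u y(1) by (simp add: kernel_def)
    then have "int l ^ e dvd f (u \<otimes> y [^] k)" by (rule dvd)
    moreover have "[f (u \<otimes> y [^] k) = f u + k * f y] (mod int l ^ e)"
      by (rule cong_dvd_modulus[OF f_comb[OF u y(1)] eN])
    ultimately show ?thesis by (simp add: cong_dvd_iff)
  qed
  \<comment> \<open>The power of y with exponent l ^ (n - b) lies in the kernel of g; this produces the multiplier m.\<close>
  have "int l ^ e dvd f \<one> + int l ^ (n - b) * f y"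
    by (rule kill) (use assms(3) in \<open>simp_all add: cong_def flip: power_add\<close>)
  then obtain m where m: "int l ^ (n - b) * f y = int l ^ e * m"
    by (auto elim: dvdE)
  have "int l ^ (n - b) * (int l ^ (n - e) * f y) = int l ^ (n - e) * (int l ^ (n - b) * f y)"
    by (rule mult.left_commute)
  also have "\<dots> = int l ^ (n - e) * int l ^ e * m"
    by (simp only: m mult.assoc)
  also have "int l ^ (n - e) * int l ^ e = int l ^ (n - b) * int l ^ b"
    using e assms(3) by (simp flip: power_add)
  finally have fy: "int l ^ (n - e) * f y = int l ^ b * m"
    using lpos by simp
  have "?N dvd int l ^ (n - e) * f u + (- m) * g u" if u: "u \<in> carrier G" for u
  proof -
    obtain k where k: "g u = int l ^ b * k" using dvd_g[OF u] by (auto elim: dvdE)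
    have "int l ^ e dvd f u + (- k) * f y"
      by (rule kill[OF u]) (simp add: k)
    then have "int l ^ (n - e) * int l ^ e dvd int l ^ (n - e) * (f u + (- k) * f y)"
      by (rule mult_dvd_mono[OF dvd_refl])
    also have "int l ^ (n - e) * (f u + (- k) * f y) = int l ^ (n - e) * f u - k * (int l ^ (n - e) * f y)"
      by (simp add: algebra_simps)
    also have "\<dots> = int l ^ (n - e) * f u + (- m) * g u"
      unfolding fy k by (simp add: algebra_simps)
    also have "int l ^ (n - e) * int l ^ e = ?N" using e by (simp flip: power_add)
    finally show ?thesis .
  qed
  then have "\<forall>u\<in>carrier G. ?N dvd int l ^ (n - e) * f u"
    using indep by blast
  then have "e \<le> a" using ord_f e assms(2) by (auto simp: prime_power_dvd_iff_int[OF l])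
  moreover have "a \<le> e"
  proof -
    have "[f x = int l ^ e] (mod int l ^ a)"
      by (rule cong_dvd_modulus[OF x(2)]) (simp add: le_imp_power_dvd assms(2))
    then show ?thesis using dvd_f[OF xG] by (simp add: cong_dvd_iff prime_power_dvd_iff_int[OF l])
  qed
  ultimately show thesis using that[OF xG] x(2) gx by auto
qed

section \<open>Independent pairs in a commutative group\<close>

text \<open>
  Independence is stated with integer exponents: it is what quasi-independence provides, and it gives
  both the trivial intersection and the injectivity of the parametrisation.
\<close>

lemma (in comm_group) independent_pair:
  fixes p q :: nat
  assumes x: "x \<in> carrier G" and y: "y \<in> carrier G"
    and p: "ord x = p" "0 < p" and q: "ord y = q" "0 < q"
    and indep: "\<And>(i :: int) (j :: int). x [^] i \<otimes> y [^] j = \<one> \<Longrightarrow> x [^] i = \<one> \<and> y [^] j = \<one>"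
  shows "generate G {x, y} = generate G {x} <#> generate G {y}"
    and "generate G {x} \<inter> generate G {y} = {\<one>}"
    and "(\<lambda>(i, j). x [^] i \<otimes> y [^] j) \<in>
      iso (integer_mod_group p \<times>\<times> integer_mod_group q) (subgroup_generated G {x, y})"
proof -
  note gen = generate_pow[OF x] generate_pow[OF y]
  have sub: "subgroup (generate G {x} <#> generate G {y}) G"
    by (intro mult_subgroups generate_is_subgroup) (use x y in auto)
  show gen_xy: "generate G {x, y} = generate G {x} <#> generate G {y}"
  proof
    have "x \<otimes> \<one> \<in> generate G {x} <#> generate G {y}" "\<one> \<otimes> y \<in> generate G {x} <#> generate G {y}"
      unfolding set_mult_def by (blast intro: generate.incl generate.one)+
    then have "x \<in> generate G {x} <#> generate G {y}" "y \<in> generate G {x} <#> generate G {y}"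
      using x y by auto
    then show "generate G {x, y} \<subseteq> generate G {x} <#> generate G {y}"
      by (intro generate_subgroup_incl[OF _ sub]) auto
    have "generate G {x} \<subseteq> generate G {x, y}" "generate G {y} \<subseteq> generate G {x, y}"
      by (auto intro!: mono_generate)
    then show "generate G {x} <#> generate G {y} \<subseteq> generate G {x, y}"
      by (auto simp: set_mult_def intro: generate.eng)
  qed
  have "z = \<one>" if z: "z \<in> generate G {x}" "z \<in> generate G {y}" for z
  proof -
    obtain i j :: int where ij: "z = x [^] i" "z = y [^] j"
      using z unfolding gen by blast
    then have "x [^] i \<otimes> y [^] (- j) = \<one>" using x y by (simp add: int_pow_neg)
    then show ?thesis using indep ij(1) by metis
  qed
  then show "generate G {x} \<inter> generate G {y} = {\<one>}"
    using generate.one by auto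
  have px: "x [^] (i mod int p) = x [^] i" for i :: int
    using x p by (simp add: int_pow_eq mod_eq_dvd_iff[symmetric])
  have qy: "y [^] (i mod int q) = y [^] i" for i :: int
    using y q by (simp add: int_pow_eq mod_eq_dvd_iff[symmetric])
  let ?\<phi> = "\<lambda>(i :: int, j :: int). x [^] i \<otimes> y [^] j"
  let ?P = "integer_mod_group p \<times>\<times> integer_mod_group q"
  have cP: "carrier ?P = {0..<int p} \<times> {0..<int q}"
    using p q by (simp add: DirProd_def carrier_integer_mod_group)
  have carr: "carrier (subgroup_generated G {x, y}) = generate G {x} <#> generate G {y}"
    using x y by (simp add: carrier_subgroup_generated gen_xy)
  show "?\<phi> \<in> iso ?P (subgroup_generated G {x, y})"
  proof (rule isoI)
    show "?\<phi> \<in> hom ?P (subgroup_generated G {x, y})"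
    proof (rule homI)
      fix s assume "s \<in> carrier ?P"
      show "?\<phi> s \<in> carrier (subgroup_generated G {x, y})"
        unfolding carr set_mult_def gen by (cases s) auto
    next
      fix s t
      show "?\<phi> (s \<otimes>\<^bsub>?P\<^esub> t) = ?\<phi> s \<otimes>\<^bsub>subgroup_generated G {x, y}\<^esub> ?\<phi> t"
        using x y by (cases s; cases t)
          (simp add: DirProd_def px qy int_pow_mult m_ac)
    qed
    show "bij_betw ?\<phi> (carrier ?P) (carrier (subgroup_generated G {x, y}))"
    proof (rule bij_betw_imageI)
      show "inj_on ?\<phi> (carrier ?P)"
      proof (rule inj_onI)
        fix s t assume s: "s \<in> carrier ?P" and t: "t \<in> carrier ?P" and eq: "?\<phi> s = ?\<phi> t"
        obtain i j i' j' where st: "s = (i, j)" "t = (i', j')" by (cases s; cases t)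
        have "x [^] (i - i') \<otimes> y [^] (j - j') = ?\<phi> s \<otimes> inv (?\<phi> t)"
          using x y by (simp add: st int_pow_diff inv_mult m_ac)
        also have "\<dots> = \<one>" unfolding eq using x y by (simp add: st)
        finally have "x [^] (i - i') = \<one>" "y [^] (j - j') = \<one>" using indep by blast+
        then have "int p dvd i - i'" "int q dvd j - j'"
          using int_pow_eq_id[OF x] int_pow_eq_id[OF y] p q by auto
        then have "i mod int p = i' mod int p" "j mod int q = j' mod int q"
          by (auto simp: mod_eq_dvd_iff)
        then show "s = t" using s t unfolding cP st by auto
      qed
      show "?\<phi> ` carrier ?P = carrier (subgroup_generated G {x, y})"
      proof
        show "?\<phi> ` carrier ?P \<subseteq> carrier (subgroup_generated G {x, y})"
          unfolding carr set_mult_def gen by auto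
        show "carrier (subgroup_generated G {x, y}) \<subseteq> ?\<phi> ` carrier ?P"
        proof
          fix z assume "z \<in> carrier (subgroup_generated G {x, y})"
          then obtain i j :: int where "z = ?\<phi> (i, j)"
            unfolding carr set_mult_def gen by auto
          then have "z = ?\<phi> (i mod int p, j mod int q)" by (simp add: px qy)
          moreover have "(i mod int p, j mod int q) \<in> carrier ?P"
            unfolding cP using p q by auto
          ultimately show "z \<in> ?\<phi> ` carrier ?P" by blast
        qed
      qed
    qed
  qed
qed

section \<open>The module of homomorphisms vanishing at minus one\<close>

lemma add_monoid_Rn: "l > 0 \<Longrightarrow> add_monoid (Rn l n) = integer_mod_group (l ^ n)"
  by (auto simp: residue_ring_def integer_mod_group_def integer_group_def)

locale GKa_module = field K for K (structure) +
  fixes l n :: nat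
  assumes l_prime: "Factorial_Ring.prime l"
begin

abbreviation "N \<equiv> int l ^ n"
text \<open>
  Kept opaque, because the simplifier would otherwise turn \<open>\<otimes>\<close> and \<open>\<one>\<close> of this group into \<open>\<oplus>\<close> and
  \<open>\<zero>\<close> of the module, out of reach of the theory of multiplicative groups.
\<close>

definition "M = add_monoid (GKa K l n)"

lemma l_pos: "0 < l"
  by (rule prime_gt_0_nat[OF l_prime])

lemma N_pos: "0 < N"
  using l_pos by simp

lemma GKa_carrier_iff: "h \<in> carrier M \<longleftrightarrow> h \<in> hom (units_of K) (integer_mod_group (l ^ n)) \<and>
    h \<in> extensional (Units K) \<and> h (\<ominus> \<one>) = 0"
  unfolding M_def GKa_def partial_object.simps mem_Collect_eq add_monoid_Rn[OF l_pos]
  by (simp add: residue_ring_def)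

lemma GKa_value_range: "h \<in> carrier M \<Longrightarrow> u \<in> Units K \<Longrightarrow> h u \<in> {0..<N}"
  using l_pos by (auto simp: GKa_carrier_iff hom_def carrier_integer_mod_group units_of_carrier)

lemma minus_one_unit: "\<ominus> \<one> \<in> Units K"
  by (rule Units_minus_one_closed)

lemma GKa_eqI:
  assumes "h \<in> carrier M" "k \<in> carrier M" "\<And>u. u \<in> Units K \<Longrightarrow> h u = k u"
  shows "h = k"
  using assms by (auto simp: GKa_carrier_iff intro: extensionalityI)

lemma GKa_one: "\<one>\<^bsub>M\<^esub> = (\<lambda>u\<in>Units K. 0)"
  and GKa_mult: "h \<otimes>\<^bsub>M\<^esub> k = (\<lambda>u\<in>Units K. (h u + k u) mod N)"
  and GKa_smult: "r \<odot>\<^bsub>GKa K l n\<^esub> h = (\<lambda>u\<in>Units K. (r * h u) mod N)"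
  by (simp_all add: M_def GKa_def residue_ring_def)

lemma GKa_one_closed: "\<one>\<^bsub>M\<^esub> \<in> carrier M"
  using l_pos minus_one_unit
  by (auto simp: GKa_carrier_iff GKa_one hom_def units_of_carrier units_of_mult)

text \<open>
  Products and inverses in \<open>M\<close>, and scalar multiples, are all special cases.
\<close>

lemma GKa_linear_combination_closed:
  assumes "h \<in> carrier M" "k \<in> carrier M"
  shows "(\<lambda>u\<in>Units K. (r * h u + s * k u) mod N) \<in> carrier M"
proof -
  have "(r * ((h u + h v) mod N) + s * ((k u + k v) mod N)) mod N =
      ((r * h u + s * k u) mod N + (r * h v + s * k v) mod N) mod N" for u v
  proof -
    have "[r * ((h u + h v) mod N) + s * ((k u + k v) mod N) = r * (h u + h v) + s * (k u + k v)] (mod N)"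
      by (intro cong_add cong_mult) (auto simp: cong_def)
    also have "r * (h u + h v) + s * (k u + k v) = (r * h u + s * k u) + (r * h v + s * k v)"
      by (simp add: algebra_simps)
    finally show ?thesis by (simp add: cong_def mod_add_eq)
  qed
  then show ?thesis
    using assms l_pos minus_one_unit
    by (auto simp: GKa_carrier_iff hom_def units_of_carrier units_of_mult carrier_integer_mod_group
        simp flip: of_nat_power)
qed

lemma GKa_mult_closed: "h \<in> carrier M \<Longrightarrow> k \<in> carrier M \<Longrightarrow> h \<otimes>\<^bsub>M\<^esub> k \<in> carrier M"
  using GKa_linear_combination_closed[of h k 1 1] by (simp only: GKa_mult mult_1)

lemma GKa_comm_group: "comm_group M"
proof (rule comm_groupI)
  fix h k assume hk: "h \<in> carrier M" "k \<in> carrier M"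
  show "h \<otimes>\<^bsub>M\<^esub> k \<in> carrier M" by (rule GKa_mult_closed[OF hk])
  show "h \<otimes>\<^bsub>M\<^esub> k = k \<otimes>\<^bsub>M\<^esub> h" by (simp only: GKa_mult add.commute)
next
  show "\<one>\<^bsub>M\<^esub> \<in> carrier M" by (rule GKa_one_closed)
next
  fix h k m assume "h \<in> carrier M" "k \<in> carrier M" "m \<in> carrier M"
  then show "h \<otimes>\<^bsub>M\<^esub> k \<otimes>\<^bsub>M\<^esub> m = h \<otimes>\<^bsub>M\<^esub> (k \<otimes>\<^bsub>M\<^esub> m)"
    by (intro GKa_eqI GKa_mult_closed) (simp_all add: GKa_mult mod_add_left_eq mod_add_right_eq add.assoc)
next
  fix h assume h: "h \<in> carrier M"
  show "\<one>\<^bsub>M\<^esub> \<otimes>\<^bsub>M\<^esub> h = h"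
    using GKa_value_range[OF h]
    by (intro GKa_eqI GKa_mult_closed GKa_one_closed h)
       (simp add: GKa_mult GKa_one)
  show "\<exists>k\<in>carrier M. k \<otimes>\<^bsub>M\<^esub> h = \<one>\<^bsub>M\<^esub>"
  proof
    show c: "(\<lambda>u\<in>Units K. ((-1) * h u + 0 * h u) mod N) \<in> carrier M"
      by (rule GKa_linear_combination_closed[OF h h])
    show "(\<lambda>u\<in>Units K. ((-1) * h u + 0 * h u) mod N) \<otimes>\<^bsub>M\<^esub> h = \<one>\<^bsub>M\<^esub>"
      unfolding GKa_mult GKa_one by (rule restrict_ext) (simp add: mod_add_left_eq)
  qed
qed

sublocale M: comm_group M
  by (rule GKa_comm_group)

lemma GKa_evaluation_hom: "u \<in> Units K \<Longrightarrow> (\<lambda>h. h u) \<in> hom M (integer_mod_group (l ^ n))"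
  using GKa_value_range
  by (intro homI) (simp_all add: GKa_mult carrier_integer_mod_group l_pos)

lemma GKa_pow_eval:
  fixes r :: int
  assumes "h \<in> carrier M" "u \<in> Units K"
  shows "(h [^]\<^bsub>M\<^esub> r) u = (r * h u) mod N"
  using hom_int_pow[OF GKa_evaluation_hom[OF assms(2)] assms(1) M.is_group group_integer_mod_group, of r]
  by (simp add: int_pow_integer_mod_group)

text \<open>
  This lets the module statements be proved in the group \<open>M\<close>.
\<close>

lemma GKa_smult_eq_pow:
  assumes "h \<in> carrier M" shows "r \<odot>\<^bsub>GKa K l n\<^esub> h = h [^]\<^bsub>M\<^esub> r"
proof (rule GKa_eqI)
  show "r \<odot>\<^bsub>GKa K l n\<^esub> h \<in> carrier M"
    using GKa_linear_combination_closed[OF assms assms, of r 0] by (simp add: GKa_smult)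
qed (use assms in \<open>simp_all add: GKa_smult GKa_pow_eval M.int_pow_closed\<close>)

lemma GKa_combination_eq_one_iff:
  fixes i j :: int
  assumes "h \<in> carrier M" "k \<in> carrier M"
  shows "h [^]\<^bsub>M\<^esub> i \<otimes>\<^bsub>M\<^esub> k [^]\<^bsub>M\<^esub> j = \<one>\<^bsub>M\<^esub> \<longleftrightarrow> (\<forall>u\<in>Units K. N dvd i * h u + j * k u)"
proof -
  have "(h [^]\<^bsub>M\<^esub> i \<otimes>\<^bsub>M\<^esub> k [^]\<^bsub>M\<^esub> j) u = (i * h u + j * k u) mod N" if "u \<in> Units K" for u
    unfolding GKa_mult using that assms by (simp add: GKa_pow_eval mod_add_eq)
  then have "(\<forall>u\<in>Units K. N dvd i * h u + j * k u) \<longleftrightarrow>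
      (\<forall>u\<in>Units K. (h [^]\<^bsub>M\<^esub> i \<otimes>\<^bsub>M\<^esub> k [^]\<^bsub>M\<^esub> j) u = \<one>\<^bsub>M\<^esub> u)"
    unfolding GKa_one by (simp add: dvd_eq_mod_eq_0)
  also have "\<dots> \<longleftrightarrow> h [^]\<^bsub>M\<^esub> i \<otimes>\<^bsub>M\<^esub> k [^]\<^bsub>M\<^esub> j = \<one>\<^bsub>M\<^esub>"
    using GKa_eqI[of "h [^]\<^bsub>M\<^esub> i \<otimes>\<^bsub>M\<^esub> k [^]\<^bsub>M\<^esub> j" "\<one>\<^bsub>M\<^esub>"] assms
      M.m_closed M.int_pow_closed M.one_closed by metis
  finally show ?thesis by blast
qed

lemma GKa_pow_eq_one_iff:
  fixes r :: int
  assumes h: "h \<in> carrier M"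
  shows "h [^]\<^bsub>M\<^esub> r = \<one>\<^bsub>M\<^esub> \<longleftrightarrow> (\<forall>u\<in>Units K. N dvd r * h u)"
  using GKa_combination_eq_one_iff[OF h h, of r 0] M.int_pow_closed[OF h, of r] M.r_one
  by simp

text \<open>
  Quasi-independence speaks of coefficients in \<open>Rn l n\<close> and of a sum over the indices with nonzero
  coefficient. Reducing integer exponents modulo \<open>N\<close> does not change the powers, and the omitted
  indices contribute zero.
\<close>

lemma quasi_independent_pair:
  fixes i j :: int
  assumes qi: "quasi_independent (Rn l n) (GKa K l n) {..<2::nat} ((!) [f, g])"
    and f: "f \<in> carrier M" and g: "g \<in> carrier M"
    and rel: "f [^]\<^bsub>M\<^esub> i \<otimes>\<^bsub>M\<^esub> g [^]\<^bsub>M\<^esub> j = \<one>\<^bsub>M\<^esub>"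
  shows "f [^]\<^bsub>M\<^esub> i = \<one>\<^bsub>M\<^esub> \<and> g [^]\<^bsub>M\<^esub> j = \<one>\<^bsub>M\<^esub>"
proof -
  define c where "c k = (if k = (0 :: nat) then i mod N else j mod N)" for k
  let ?v = "\<lambda>k. c k \<odot>\<^bsub>GKa K l n\<^esub> [f, g] ! k"
  have pow_mod: "h [^]\<^bsub>M\<^esub> (r mod N) = h [^]\<^bsub>M\<^esub> r" if "h \<in> carrier M" for h and r :: int
    using that by (intro GKa_eqI) (simp_all add: GKa_pow_eval M.int_pow_closed mod_mult_left_eq)
  have v: "?v 0 = f [^]\<^bsub>M\<^esub> i" "?v 1 = g [^]\<^bsub>M\<^esub> j"
    using f g by (simp_all add: c_def GKa_smult_eq_pow pow_mod)
  have two: "{..<2::nat} = {0, 1}" by auto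
  have v_closed: "?v \<in> {..<2} \<rightarrow> carrier M"
    using v f g unfolding two by (auto simp: M.int_pow_closed)
  have c: "c \<in> {..<2} \<rightarrow> carrier (Rn l n)"
    using N_pos by (auto simp: c_def residue_ring_def)
  have zero: "?v k = \<one>\<^bsub>M\<^esub>" if "c k = 0" for k
    using that by (simp add: GKa_smult GKa_one)
  have "(\<Oplus>\<^bsub>GKa K l n\<^esub>k \<in> {k \<in> {..<2}. c k \<noteq> \<zero>\<^bsub>Rn l n\<^esub>}. ?v k)
      = finprod M ?v {k \<in> {..<2}. c k \<noteq> 0}"
    by (simp add: finsum_def residue_ring_def M_def)
  also have "\<dots> = finprod M ?v {..<2}"
    by (rule M.finprod_mono_neutral_cong_left) (use v_closed zero in auto)
  also have "\<dots> = ?v 0 \<otimes>\<^bsub>M\<^esub> ?v 1"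
    using v_closed unfolding two by (simp add: M.finprod_insert Pi_def)
  also have "\<dots> = \<zero>\<^bsub>GKa K l n\<^esub>" using rel unfolding v by (simp add: M_def)
  finally have "\<forall>k\<in>{..<2}. ?v k = \<zero>\<^bsub>GKa K l n\<^esub>"
    using qi c unfolding quasi_independent_def by (auto simp: lessThan_def)
  then show ?thesis using v unfolding two by (auto simp: M_def)
qed

end

section \<open>C-pairs and the order of the K-group\<close>

theorem proposition6p1:
  fixes l n a b c :: nat
    and K :: "('a, 'b) ring_scheme"
    and f g :: "'a \<Rightarrow> int"
    and T :: "'a set"
  assumes "Factorial_Ring.prime l"
    and "1 \<le> n"
    and "field K"
    and "f \<in> carrier (GKa K l n)"
    and "g \<in> carrier (GKa K l n)"
    and "quasi_independent (Rn l n) (GKa K l n) {..<2::nat} ((!) [f, g])"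
    and "a \<le> n"
    and "b \<le> n"
    and "group.ord (add_monoid (GKa K l n)) f = l ^ (n - a)"
    and "group.ord (add_monoid (GKa K l n)) g = l ^ (n - b)"
    and "T = kernel (units_of K) (add_monoid (Rn l n)) f \<inter> kernel (units_of K) (add_monoid (Rn l n)) g"
    and "c \<le> n"
    and "order (K2M_mod K T) = l ^ (n - c)"
  shows "generate (add_monoid (GKa K l n)) {f, g} =
           generate (add_monoid (GKa K l n)) {f} <+>\<^bsub>GKa K l n\<^esub> generate (add_monoid (GKa K l n)) {g}
       \<and> generate (add_monoid (GKa K l n)) {f} \<inter> generate (add_monoid (GKa K l n)) {g} = {\<zero>\<^bsub>GKa K l n\<^esub>}
       \<and> (\<lambda>(i, j). i \<odot>\<^bsub>GKa K l n\<^esub> f \<oplus>\<^bsub>GKa K l n\<^esub> j \<odot>\<^bsub>GKa K l n\<^esub> g)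
           \<in> iso (integer_mod_group (l ^ (n - a)) \<times>\<times> integer_mod_group (l ^ (n - b)))
               (subgroup_generated (add_monoid (GKa K l n)) {f, g})
       \<and> (C_pair K l n f g \<longleftrightarrow> c \<le> a + b)"
proof (intro conjI)
  interpret field K by fact
  interpret GKa_module K l n
    by unfold_locales (fact assms(1))
  have f: "f \<in> carrier M" and g: "g \<in> carrier M"
    using assms(4,5) by (simp_all add: M_def)
  have ord: "M.ord f = l ^ (n - a)" "M.ord g = l ^ (n - b)"
    using assms(9,10) by (simp_all add: M_def)
  have indep: "f [^]\<^bsub>M\<^esub> i = \<one>\<^bsub>M\<^esub> \<and> g [^]\<^bsub>M\<^esub> j = \<one>\<^bsub>M\<^esub>"
    if "f [^]\<^bsub>M\<^esub> i \<otimes>\<^bsub>M\<^esub> g [^]\<^bsub>M\<^esub> j = \<one>\<^bsub>M\<^esub>" for i j :: int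
    by (rule quasi_independent_pair[OF assms(6) f g that])
  note pair = M.independent_pair[OF f g ord(1) _ ord(2) _ indep]
  show "generate (add_monoid (GKa K l n)) {f, g} =
      generate (add_monoid (GKa K l n)) {f} <+>\<^bsub>GKa K l n\<^esub> generate (add_monoid (GKa K l n)) {g}"
    using pair(1) l_pos by (simp add: M_def set_add_def)
  show "generate (add_monoid (GKa K l n)) {f} \<inter> generate (add_monoid (GKa K l n)) {g} = {\<zero>\<^bsub>GKa K l n\<^esub>}"
    using pair(2) l_pos by (simp add: M_def)
  have "(\<lambda>(i, j). i \<odot>\<^bsub>GKa K l n\<^esub> f \<oplus>\<^bsub>GKa K l n\<^esub> j \<odot>\<^bsub>GKa K l n\<^esub> g) =
      (\<lambda>(i, j). f [^]\<^bsub>M\<^esub> i \<otimes>\<^bsub>M\<^esub> g [^]\<^bsub>M\<^esub> j)"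
    using f g by (simp add: GKa_smult_eq_pow) (simp add: M_def)
  then show "(\<lambda>(i, j). i \<odot>\<^bsub>GKa K l n\<^esub> f \<oplus>\<^bsub>GKa K l n\<^esub> j \<odot>\<^bsub>GKa K l n\<^esub> g)
      \<in> iso (integer_mod_group (l ^ (n - a)) \<times>\<times> integer_mod_group (l ^ (n - b)))
          (subgroup_generated (add_monoid (GKa K l n)) {f, g})"
    using pair(3) l_pos by (simp add: M_def)

  let ?P = "integer_mod_group (l ^ n)"
  interpret U: comm_group "units_of K" by (rule units_comm_group)
  have cU: "carrier (units_of K) = Units K" by (rule units_of_carrier)
  have fh: "f \<in> hom (units_of K) ?P" "f (\<ominus>\<^bsub>K\<^esub> \<one>\<^bsub>K\<^esub>) = 0"
    and gh: "g \<in> hom (units_of K) ?P" "g (\<ominus>\<^bsub>K\<^esub> \<one>\<^bsub>K\<^esub>) = 0"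
    using f g by (simp_all add: GKa_carrier_iff)
  interpret f: group_hom "units_of K" ?P f
    by (intro group_hom.intro group_hom_axioms.intro fh(1)) auto
  interpret g: group_hom "units_of K" ?P g
    by (intro group_hom.intro group_hom_axioms.intro gh(1)) auto
  have T: "T = kernel (units_of K) ?P f \<inter> kernel (units_of K) ?P g"
    using assms(11) by (simp only: add_monoid_Rn[OF l_pos])
  have T_iff: "t \<in> T \<longleftrightarrow> t \<in> Units K \<and> f t = 0 \<and> g t = 0" for t
    by (auto simp: T kernel_def cU)
  interpret K2: K2M_quotient K T
  proof (intro K2M_quotient.intro K2M_quotient_axioms.intro)
    show "field K" by fact
    show "subgroup T (units_of K)"
      unfolding T by (intro U.subgroups_Inter_pair f.subgroup_kernel g.subgroup_kernel)
    show "\<ominus>\<^bsub>K\<^esub> \<one>\<^bsub>K\<^esub> \<in> T"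
      using fh gh minus_one_unit by (simp add: T_iff)
  qed

  have ord_f: "(\<forall>u\<in>carrier (units_of K). N dvd r * f u) \<longleftrightarrow> int l ^ (n - a) dvd r" for r :: int
    using GKa_pow_eq_one_iff[OF f, of r] M.int_pow_eq_id[OF f, of r] by (simp add: cU ord)
  have ord_g: "(\<forall>u\<in>carrier (units_of K). N dvd r * g u) \<longleftrightarrow> int l ^ (n - b) dvd r" for r :: int
    using GKa_pow_eq_one_iff[OF g, of r] M.int_pow_eq_id[OF g, of r] by (simp add: cU ord)
  have indep_f: "\<forall>u\<in>carrier (units_of K). N dvd i * f u"
    if "\<forall>u\<in>carrier (units_of K). N dvd i * f u + j * g u" for i j :: int
    using that indep[of i j] GKa_combination_eq_one_iff[OF f g, of i j] GKa_pow_eq_one_iff[OF f, of i]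
    by (simp add: cU)
  have indep_g: "\<forall>u\<in>carrier (units_of K). N dvd j * g u"
    if "\<forall>u\<in>carrier (units_of K). N dvd j * g u + i * f u" for i j :: int
    using that indep[of i j] GKa_combination_eq_one_iff[OF f g, of i j] GKa_pow_eq_one_iff[OF g, of j]
    by (simp add: cU add.commute)
  obtain x where x: "x \<in> Units K" "[f x = int l ^ a] (mod N)" "[g x = 0] (mod N)"
    by (rule U.independent_residue_homs_attain_coordinate[OF l_prime assms(7,8) fh(1) gh(1) ord_f ord_g], erule indep_f)
       (simp add: cU)
  obtain y where y: "y \<in> Units K" "[g y = int l ^ b] (mod N)" "[f y = 0] (mod N)"
    by (rule U.independent_residue_homs_attain_coordinate[OF l_prime assms(8,7) gh(1) fh(1) ord_g ord_f], erule indep_g)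
       (simp add: cU)
  let ?q = "K2.symbol x y"
  have q: "?q \<in> carrier K2.Q" by (rule K2.symbol_closed[OF x(1) y(1)])
  show "C_pair K l n f g \<longleftrightarrow> c \<le> a + b"
  proof
    assume "C_pair K l n f g"
    then have C: "[f (\<one>\<^bsub>K\<^esub> \<ominus>\<^bsub>K\<^esub> z) * g z = f z * g (\<one>\<^bsub>K\<^esub> \<ominus>\<^bsub>K\<^esub> z)] (mod N)"
      if "z \<in> carrier K" "z \<noteq> \<zero>\<^bsub>K\<^esub>" "z \<noteq> \<one>\<^bsub>K\<^esub>" for z
      using that by (simp add: C_pair_def residue_ring_def cong_def)
    have fg_T: "f t = 0 \<and> g t = 0" if "t \<in> T" for t
      using that by (simp add: T_iff)
    obtain \<psi> where \<psi>: "\<psi> \<in> hom K2.Q ?P"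
      and \<psi>_symbol: "\<And>u v. u \<in> Units K \<Longrightarrow> v \<in> Units K \<Longrightarrow>
          \<psi> (K2.symbol u v) = (f u * g v - f v * g u) mod N"
      using K2.determinant_hom[OF l_pos fh(1) gh(1) _ C] fg_T by blast
    \<comment> \<open>The order of Q annihilates the image l ^ (a + b) of the symbol of x and y.\<close>
    have q_order: "?q [^]\<^bsub>K2.Q\<^esub> (l ^ (n - c)) = \<one>\<^bsub>K2.Q\<^esub>"
      using K2.Q.pow_order_eq_1[OF q] unfolding assms(13) .
    have "\<psi> ?q [^]\<^bsub>?P\<^esub> (l ^ (n - c)) = \<psi> (?q [^]\<^bsub>K2.Q\<^esub> (l ^ (n - c)))"
      by (rule hom_nat_pow[symmetric, OF \<psi> q K2.Q.is_group group_integer_mod_group])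
    also have "\<dots> = \<one>\<^bsub>?P\<^esub>"
      unfolding q_order by (rule hom_one[OF \<psi> K2.Q.is_group group_integer_mod_group])
    finally have "N dvd int l ^ (n - c) * \<psi> ?q"
      by (simp only: pow_integer_mod_group one_integer_mod_group of_nat_power dvd_eq_mod_eq_0)
    moreover have "[int l ^ (n - c) * \<psi> ?q = int l ^ (n - c) * (int l ^ a * int l ^ b - 0 * 0)] (mod N)"
    proof (rule cong_mult[OF cong_refl])
      have "[f x * g y - f y * g x = int l ^ a * int l ^ b - 0 * 0] (mod N)"
        by (rule cong_diff[OF cong_mult[OF x(2) y(2)] cong_mult[OF y(3) x(3)]])
      then show "[\<psi> ?q = int l ^ a * int l ^ b - 0 * 0] (mod N)"
        unfolding \<psi>_symbol[OF x(1) y(1)] by (simp only: cong_def mod_mod_trivial)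
    qed
    ultimately have "N dvd int l ^ (n - c + (a + b))"
      by (simp add: cong_dvd_iff power_add)
    then show "c \<le> a + b"
      using assms(12) by (simp add: prime_power_dvd_iff_int[OF l_prime])
  next
    assume le: "c \<le> a + b"
    have dvd_f: "int l ^ a dvd f u" if "u \<in> Units K" for u
      using U.residue_hom_order[OF l_prime fh(1) assms(7) ord_f] that unfolding cU by blast
    have dvd_g: "int l ^ b dvd g u" if "u \<in> Units K" for u
      using U.residue_hom_order[OF l_prime gh(1) assms(8) ord_g] that unfolding cU by blast
    \<comment> \<open>The units x and y generate all units modulo T, with exponents given by the values of f and g.\<close>
    have decompose: "\<exists>t\<in>T. u = t \<otimes>\<^bsub>K\<^esub> (x [^]\<^bsub>units_of K\<^esub> i \<otimes>\<^bsub>K\<^esub> y [^]\<^bsub>units_of K\<^esub> j)"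
      if u: "u \<in> Units K" and ij: "f u = int l ^ a * i" "g u = int l ^ b * j" for u i j
    proof -
      let ?w = "x [^]\<^bsub>units_of K\<^esub> i \<otimes>\<^bsub>units_of K\<^esub> y [^]\<^bsub>units_of K\<^esub> j"
      let ?t = "u \<otimes>\<^bsub>units_of K\<^esub> inv\<^bsub>units_of K\<^esub> ?w"
      have xU: "x \<in> carrier (units_of K)" and yU: "y \<in> carrier (units_of K)"
        and uU: "u \<in> carrier (units_of K)"
        using x(1) y(1) u by (simp_all add: cU)
      have w: "?w \<in> carrier (units_of K)" using xU yU by (intro U.m_closed U.int_pow_closed)
      have fw: "[f ?w = i * int l ^ a + j * 0] (mod N)"
      proof -
        have "f ?w = (i * f x + j * f y) mod N"
          using xU yU by (simp add: f.hom_mult f.hom_int_pow int_pow_integer_mod_group mod_add_eq)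
        moreover have "[i * f x + j * f y = i * int l ^ a + j * 0] (mod N)"
          by (intro cong_add cong_mult cong_refl x y)
        ultimately show ?thesis by (simp add: cong_def)
      qed
      have gw: "[g ?w = i * 0 + j * int l ^ b] (mod N)"
      proof -
        have "g ?w = (i * g x + j * g y) mod N"
          using xU yU by (simp add: g.hom_mult g.hom_int_pow int_pow_integer_mod_group mod_add_eq)
        moreover have "[i * g x + j * g y = i * 0 + j * int l ^ b] (mod N)"
          by (intro cong_add cong_mult cong_refl x y)
        ultimately show ?thesis by (simp add: cong_def)
      qed
      have t_eq: "h ?t = (h u - h ?w) mod N" if h: "h \<in> hom (units_of K) ?P" for h
      proof -
        interpret h: group_hom "units_of K" ?P h
          by (intro group_hom.intro group_hom_axioms.intro h) auto
        show ?thesis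
          unfolding h.hom_mult[OF uU U.inv_closed[OF w]] h.hom_inv[OF w]
          using h.hom_closed[OF w] by (simp add: mod_add_right_eq)
      qed
      have "f ?t = 0" "g ?t = 0"
        unfolding t_eq[OF fh(1)] t_eq[OF gh(1)] using fw gw ij
        by (simp_all add: cong_iff_dvd_diff dvd_diff_commute mult.commute)
      then have "?t \<in> T" using uU w U.m_closed[OF uU U.inv_closed[OF w]] by (simp only: T_iff cU)
      moreover have "u = ?t \<otimes>\<^bsub>units_of K\<^esub> ?w"
        using uU w by (simp only: U.m_assoc U.inv_closed U.l_inv U.r_one)
      ultimately show ?thesis by (auto simp: units_of_mult)
    qed
    have symbol_eq: "K2.symbol u v = ?q [^]\<^bsub>K2.Q\<^esub> (i * m - j * k)"
      if uv: "u \<in> Units K" "f u = int l ^ a * i" "g u = int l ^ b * j"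
        "v \<in> Units K" "f v = int l ^ a * k" "g v = int l ^ b * m" for u v i j k m
    proof -
      obtain t where "t \<in> T" "u = t \<otimes>\<^bsub>K\<^esub> (x [^]\<^bsub>units_of K\<^esub> i \<otimes>\<^bsub>K\<^esub> y [^]\<^bsub>units_of K\<^esub> j)"
        using decompose[OF uv(1,2,3)] by blast
      moreover obtain t' where "t' \<in> T" "v = t' \<otimes>\<^bsub>K\<^esub> (x [^]\<^bsub>units_of K\<^esub> k \<otimes>\<^bsub>K\<^esub> y [^]\<^bsub>units_of K\<^esub> m)"
        using decompose[OF uv(4,5,6)] by blast
      ultimately show ?thesis
        using K2.symbol_of_products[OF x(1) y(1)] by simp
    qed
    have coordinates: "\<exists>i j. f u = int l ^ a * i \<and> g u = int l ^ b * j" if "u \<in> Units K" for u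
      using dvd_f[OF that] dvd_g[OF that] unfolding dvd_def by blast
    \<comment> \<open>Every symbol is a power of the symbol of x and y, so the order of that symbol is the order of Q.\<close>
    have "generate K2.Q {?q} = carrier K2.Q"
    proof (rule K2.K2M_mod_subgroup_eq)
      show "subgroup (generate K2.Q {?q}) K2.Q"
        by (rule K2.Q.generate_is_subgroup) (use q in auto)
      show "K2.symbol u v \<in> generate K2.Q {?q}" if uv: "u \<in> Units K" "v \<in> Units K" for u v
      proof -
        obtain i j where "f u = int l ^ a * i" "g u = int l ^ b * j"
          using coordinates[OF uv(1)] by blast
        moreover obtain k m where "f v = int l ^ a * k" "g v = int l ^ b * m"
          using coordinates[OF uv(2)] by blast
        ultimately have "K2.symbol u v = ?q [^]\<^bsub>K2.Q\<^esub> (i * m - j * k)"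
          using symbol_eq uv by blast
        then show ?thesis unfolding K2.Q.generate_pow[OF q] by blast
      qed
    qed
    then have ord_q: "K2.Q.ord ?q = l ^ (n - c)"
      using K2.Q.generate_pow_card[OF q] assms(13) by (simp add: order_def)
    have det: "[f (\<one>\<^bsub>K\<^esub> \<ominus>\<^bsub>K\<^esub> z) * g z = f z * g (\<one>\<^bsub>K\<^esub> \<ominus>\<^bsub>K\<^esub> z)] (mod N)"
      if z: "z \<in> carrier K" "z \<noteq> \<zero>\<^bsub>K\<^esub>" "z \<noteq> \<one>\<^bsub>K\<^esub>" for z
    proof -
      let ?z' = "\<one>\<^bsub>K\<^esub> \<ominus>\<^bsub>K\<^esub> z"
      have u: "z \<in> Units K" "?z' \<in> Units K"
        using z K2.one_minus_unit by (auto simp: field_Units)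
      obtain i j where ij: "f z = int l ^ a * i" "g z = int l ^ b * j"
        using coordinates[OF u(1)] by blast
      obtain k m where km: "f ?z' = int l ^ a * k" "g ?z' = int l ^ b * m"
        using coordinates[OF u(2)] by blast
      have "?q [^]\<^bsub>K2.Q\<^esub> (i * m - j * k) = \<one>\<^bsub>K2.Q\<^esub>"
        using symbol_eq[OF u(1) ij(1,2) u(2) km] K2.symbol_steinberg[OF z] by simp
      then have d: "int l ^ (n - c) dvd i * m - j * k"
        using K2.Q.int_pow_eq_id[OF q] ord_q by simp
      have "N dvd int l ^ (a + b + (n - c))"
        using le assms(12) by (simp add: prime_power_dvd_iff_int[OF l_prime])
      also have "\<dots> dvd int l ^ (a + b) * (i * m - j * k)"
        unfolding power_add[of _ "a + b"] by (rule mult_dvd_mono[OF dvd_refl d])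
      also have "\<dots> = f z * g ?z' - f ?z' * g z"
        unfolding ij km by (simp add: power_add algebra_simps)
      finally show ?thesis by (simp add: cong_iff_dvd_diff dvd_diff_commute)
    qed
    then show "C_pair K l n f g"
      by (auto simp: C_pair_def residue_ring_def cong_def)
  qed
qed

end
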